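(* For $n>2$ there is no rank-2 real vector bundle $\mathcal E^2$ over $\mathbb S^n$ whose total space is top-ALE.
   Context: A manifold $X$ is top-AC if there exist a compact $\mathcal K\subset X$ and closed manifolds $\mathcal N_j$ such that $X\setminus\mathcal K$ is a disjoint union of ends each homeomorphic to $(0,\infty)\times\mathcal N_j$ (link $\mathcal N_j$). It is simple if each $\mathcal N_j=\widetilde{\mathcal N}_j/\Gamma_j$ for a finite group $\Gamma_j$ acting freely on $\widetilde{\mathcal N}_j$, and top-ALE if moreover every $\widetilde{\mathcal N}_j$ is homeomorphic to a sphere. *)

theory Defs
  imports "HOL-Analysis.Analysis"
begin

definition real_vector_bundle ::
  "'a topology \<Rightarrow> 'b topology \<Rightarrow> ('a \<Rightarrow> 'b) \<Rightarrow> ('v::euclidean_space) itself \<Rightarrow> bool" where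
  "real_vector_bundle E B p _ \<longleftrightarrow>
     continuous_map E B p \<and> p ` topspace E = topspace B \<and>
     (\<exists>(add :: 'a \<Rightarrow> 'a \<Rightarrow> 'a) (scale :: real \<Rightarrow> 'a \<Rightarrow> 'a).
        \<forall>b \<in> topspace B. \<exists>U (\<phi> :: 'a \<Rightarrow> 'b \<times> 'v).
          openin B U \<and> b \<in> U \<and>
          homeomorphic_map (subtopology E {e \<in> topspace E. p e \<in> U})
                           (prod_topology (subtopology B U) euclidean) \<phi> \<and>
          (\<forall>e \<in> topspace E. p e \<in> U \<longrightarrow> fst (\<phi> e) = p e) \<and>
          (\<forall>x \<in> topspace E. \<forall>y \<in> topspace E. p x \<in> U \<and> p y = p x \<longrightarrow>
              add x y \<in> topspace E \<and> p (add x y) = p x \<and>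
              snd (\<phi> (add x y)) = snd (\<phi> x) + snd (\<phi> y)) \<and>
          (\<forall>x \<in> topspace E. \<forall>c. p x \<in> U \<longrightarrow>
              scale c x \<in> topspace E \<and> p (scale c x) = p x \<and>
              snd (\<phi> (scale c x)) = c *\<^sub>R snd (\<phi> x)))"

text \<open>A finite group of homeomorphisms of the space S acting freely
  (a finite group acting freely is acting effectively, so it may be identified
  with its image in the homeomorphism group).\<close>
definition finite_free_group_action :: "'a topology \<Rightarrow> ('a \<Rightarrow> 'a) set \<Rightarrow> bool" where
  "finite_free_group_action S G \<longleftrightarrow>
     finite G \<and>
     (\<forall>g \<in> G. homeomorphic_map S S g) \<and>
     (\<exists>e \<in> G. \<forall>x \<in> topspace S. e x = x) \<and>
     (\<forall>g \<in> G. \<forall>h \<in> G. \<exists>k \<in> G. \<forall>x \<in> topspace S. k x = g (h x)) \<and>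
     (\<forall>g \<in> G. \<exists>h \<in> G. \<forall>x \<in> topspace S. h (g x) = x) \<and>
     (\<forall>g \<in> G. (\<exists>x \<in> topspace S. g x = x) \<longrightarrow> (\<forall>x \<in> topspace S. g x = x))"

definition is_orbit_space :: "'a topology \<Rightarrow> ('a \<Rightarrow> 'a) set \<Rightarrow> 'n topology \<Rightarrow> bool" where
  "is_orbit_space S G N \<longleftrightarrow>
     (\<exists>q. quotient_map S N q \<and>
          (\<forall>x \<in> topspace S. \<forall>y \<in> topspace S. q x = q y \<longleftrightarrow> (\<exists>g \<in> G. y = g x)))"

definition spherical_space_form :: "'n topology \<Rightarrow> bool" where
  "spherical_space_form N \<longleftrightarrow>
     (\<exists>m G. finite_free_group_action (nsphere m) G \<and> is_orbit_space (nsphere m) G N)"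

definition top_ALE :: "'a topology \<Rightarrow> bool" where
  "top_ALE X \<longleftrightarrow>
     (\<exists>K \<E>. compactin X K \<and>
        pairwise disjnt \<E> \<and> \<Union>\<E> = topspace X - K \<and>
        (\<forall>U \<in> \<E>. openin (subtopology X (topspace X - K)) U \<and>
           (\<exists>N :: (nat \<Rightarrow> real) set topology. spherical_space_form N \<and>
              (subtopology X U) homeomorphic_space
                (prod_topology (subtopology euclideanreal {0<..}) N))))"

end

theory Submission
  imports Defs
begin

text \<open>
  For n > 2 the bundle is trivial, so its total space is the product of the n-sphere and the
  complex plane, and outside a compact set the plane coordinate F has no zeros. Suppose an end U is
  (0,\<infinity>) times a quotient N of the m-sphere by a finite free action.
  If m \<noteq> 1, every nowhere vanishing complex function on the m-sphere has a continuous
  logarithm; summing logarithms over the orbits shows that a fixed power k of every nowhere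
  vanishing function on N has a continuous logarithm. Applied to F near infinity and restricted to a
  large circle in a single fibre, this gives a continuous logarithm of the k-th power map on
  the circle, which is absurd. If m = 1, then U is locally planar, contradicting invariance of
  dimension. Triviality of the bundle uses the same notion of logarithm: two trivializations over
  closed sets A and C can be glued as soon as A \<inter> C is connected and has logarithms.
\<close>

section \<open>Continuous logarithms\<close>

text \<open>Logarithms stand in for first cohomology: a map to the punctured plane has one exactly
  when it is null-homotopic. What they detect is the winding number of a fibre circle; a finite
  quotient only costs a power, and multiplying a winding number of infinite order by the order of
  the group does not make it vanish. For n = 2 the conclusion fails: the cotangent bundle of the
  2-sphere has one end, with link the 3-sphere modulo the antipodal map. There the equator is a
  circle, so transition functions can wind, and the fibre circle becomes torsion in the link. The
  obstacle is that an end is known only up to homeomorphism. Its slices bear no relation to the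
  sphere bundles \<open>cmod (F e) = R\<close>, the end may contain zeros of F at small radius, and
  the dimension m of the sphere covering the link is not tied to n. The two descriptions of infinity
  can be compared only through compact sets, and m = 1, the one sphere without logarithms, has to be
  excluded by a dimension count.\<close>

definition has_logs :: "'a::topological_space set \<Rightarrow> bool" where
  "has_logs S \<longleftrightarrow> (\<forall>f :: 'a \<Rightarrow> complex. continuous_on S f \<and> (\<forall>x\<in>S. f x \<noteq> 0) \<longrightarrow>
     (\<exists>g. continuous_on S g \<and> (\<forall>x\<in>S. f x = exp (g x))))"

lemma has_logsE:
  fixes f :: "'a::topological_space \<Rightarrow> complex"
  assumes "has_logs S" "continuous_on S f" "\<And>x. x \<in> S \<Longrightarrow> f x \<noteq> 0"
  obtains g where "continuous_on S g" "\<And>x. x \<in> S \<Longrightarrow> f x = exp (g x)"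
  using assms unfolding has_logs_def by blast

text \<open>The values of d lie in the integer multiples of 2 pi i, a set in which distinct points
  are at least 2 pi apart. The empty set is included because the equator of \<open>Sph 0\<close> is
  empty.\<close>

lemma continuous_exp_eq_1_constant:
  fixes d :: "'a::topological_space \<Rightarrow> complex"
  assumes "connected C" "continuous_on C d" "\<And>x. x \<in> C \<Longrightarrow> exp (d x) = 1"
  shows "\<exists>c. exp c = 1 \<and> (\<forall>x\<in>C. d x = c)"
proof (cases "C = {}")
  case False
  have "d constant_on C"
  proof (rule continuous_discrete_range_constant [OF assms(1,2)])
    fix x assume x: "x \<in> C"
    have "2*pi \<le> norm (d y - d x)" if y: "y \<in> C" "d y \<noteq> d x" for y
    proof -
      have "\<exists>m::int. d z = of_real (2*pi*m) * \<i>" if "z \<in> C" for z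
        using assms(3)[OF that] unfolding exp_eq_1 by (auto simp: complex_eq_iff)
      then obtain m n :: int where mn: "d x = of_real (2*pi*m) * \<i>" "d y = of_real (2*pi*n) * \<i>"
        using x y by blast
      then have "d y - d x = of_real (2*pi*(n-m)) * \<i>" by (simp add: algebra_simps)
      then have "norm (d y - d x) = 2*pi*\<bar>real_of_int (n-m)\<bar>"
        by (simp only: norm_mult norm_of_real) (simp add: abs_mult)
      moreover have "1 \<le> \<bar>real_of_int (n-m)\<bar>" using mn y by auto
      ultimately show ?thesis by (simp add: mult_left_mono)
    qed
    then show "\<exists>e>0. \<forall>y. y \<in> C \<and> d y \<noteq> d x \<longrightarrow> e \<le> norm (d y - d x)"
      by (intro exI[of _ "2*pi"]) auto
  qed
  with False assms(3) show ?thesis unfolding constant_on_def by fastforce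
qed (auto intro: exI[of _ 0])

text \<open>On the overlap two logarithms of f differ by a period of exp, constant by connectedness;
  shifting one of them by it makes them fit together.\<close>

lemma has_logs_Un:
  assumes S: "closedin (top_of_set (S \<union> T)) S" and T: "closedin (top_of_set (S \<union> T)) T"
    and con: "connected (S \<inter> T)" and lS: "has_logs S" and lT: "has_logs T"
  shows "has_logs (S \<union> T)"
  unfolding has_logs_def
proof (intro allI impI, elim conjE)
  fix f :: "'a \<Rightarrow> complex"
  assume f: "continuous_on (S \<union> T) f" "\<forall>x\<in>S \<union> T. f x \<noteq> 0"
  obtain g where g: "continuous_on S g" "\<And>x. x \<in> S \<Longrightarrow> f x = exp (g x)"
    using has_logsE [OF lS, of f] f continuous_on_subset by (metis UnI1 Un_upper1)
  obtain h where h: "continuous_on T h" "\<And>x. x \<in> T \<Longrightarrow> f x = exp (h x)"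
    using has_logsE [OF lT, of f] f continuous_on_subset by (metis UnI2 Un_upper2)
  have "continuous_on (S \<inter> T) (\<lambda>x. g x - h x)"
    using g(1) h(1) by (intro continuous_on_diff) (auto elim: continuous_on_subset)
  moreover have "exp (g x - h x) = 1" if "x \<in> S \<inter> T" for x
    using g(2)[of x] h(2)[of x] that by (simp add: exp_diff)
  ultimately obtain c where c: "exp c = 1" "\<forall>x\<in>S \<inter> T. g x - h x = c"
    using continuous_exp_eq_1_constant [OF con] by blast
  define k where "k x = (if x \<in> S then g x else h x + c)" for x
  have "continuous_on (S \<union> T) k"
    unfolding k_def
    by (rule continuous_on_cases_local [OF S T g(1)])
       (use c h in \<open>auto intro!: continuous_intros simp: algebra_simps\<close>)
  moreover have "f x = exp (k x)" if "x \<in> S \<union> T" for x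
    using that g(2) h(2) c(1) by (auto simp: k_def exp_add)
  ultimately show "\<exists>g. continuous_on (S \<union> T) g \<and> (\<forall>x\<in>S \<union> T. f x = exp (g x))" by blast
qed

lemma has_logs_homeomorphism:
  assumes hom: "homeomorphism S T h k" and lS: "has_logs S"
  shows "has_logs T"
  unfolding has_logs_def
proof (intro allI impI, elim conjE)
  fix f :: "'b \<Rightarrow> complex"
  assume f: "continuous_on T f" "\<forall>x\<in>T. f x \<noteq> 0"
  have "continuous_on S (f \<circ> h)"
    using hom f(1) by (metis continuous_on_compose homeomorphism_def)
  then obtain g where g: "continuous_on S g" "\<And>x. x \<in> S \<Longrightarrow> (f \<circ> h) x = exp (g x)"
    using has_logsE [OF lS, of "f \<circ> h"] f hom by (auto simp: homeomorphism_def)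
  have "continuous_on T (g \<circ> k)"
    using hom g(1) by (metis continuous_on_compose homeomorphism_def)
  moreover have "f x = exp ((g \<circ> k) x)" if "x \<in> T" for x
    using g(2)[of "k x"] hom that by (auto simp: homeomorphism_def)
  ultimately show "\<exists>g. continuous_on T g \<and> (\<forall>x\<in>T. f x = exp (g x))" by blast
qed

lemma convex_has_logs:
  fixes S :: "'a::real_normed_vector set"
  assumes "convex S" shows "has_logs S"
  using convex_imp_Borsukian [OF assms]
  unfolding Borsukian_continuous_logarithm has_logs_def by blast

section \<open>Spheres and their cells\<close>

definition Sph :: "nat \<Rightarrow> (nat \<Rightarrow> real) set" where
  "Sph n = {x. (\<Sum>i\<le>n. (x i)\<^sup>2) = 1 \<and> (\<forall>i>n. x i = 0)}"

lemma nsphere_eq_top_of_set: "nsphere n = top_of_set (Sph n)"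
  by (simp add: nsphere Sph_def euclidean_product_topology)

text \<open>The sign \<open>s\<close> (1 or -1) selects one of the two closed hemispheres.\<close>

definition cell :: "real \<Rightarrow> nat \<Rightarrow> (nat \<Rightarrow> real) \<Rightarrow> (nat \<Rightarrow> real) \<Rightarrow> (nat \<Rightarrow> real) set" where
  "cell s n L H = {x \<in> Sph n. 0 \<le> s * x n \<and> (\<forall>i<n. L i \<le> x i \<and> x i \<le> H i)}"

text \<open>The ambient type \<open>nat \<Rightarrow> real\<close> of the spheres is not a normed space, so convexity arguments are
  carried out in the space of bounded sequences.\<close>

definition unit_seq :: "nat \<Rightarrow> (nat \<Rightarrow>\<^sub>C real)" where
  "unit_seq i = Bcontfun (\<lambda>j. if j = i then 1 else 0)"

lemma apply_unit_seq: "apply_bcontfun (unit_seq i) j = (if j = i then 1 else 0)"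
proof -
  have "(\<lambda>j. if j = i then 1 else 0 :: real) \<in> bcontfun"
    by (auto simp: bcontfun_def intro!: finite_imp_bounded finite_subset[of _ "{0,1}"])
  then show ?thesis by (simp add: unit_seq_def Bcontfun_inverse)
qed

lemma apply_bcontfun_sum: "apply_bcontfun (sum f A) j = (\<Sum>i\<in>A. apply_bcontfun (f i) j)"
  by (induction A rule: infinite_finite_induct) (auto simp: plus_bcontfun.rep_eq zero_bcontfun.rep_eq)

lemma apply_unit_seq_sum:
  "apply_bcontfun (\<Sum>i<n. x i *\<^sub>R unit_seq i) j = (if j < n then x j else 0)"
  by (simp add: apply_bcontfun_sum apply_unit_seq if_distrib cong: if_cong)

lemma continuous_on_apply_bcontfun_at: "continuous_on S (\<lambda>v :: 'a::topological_space \<Rightarrow>\<^sub>C 'b::metric_space. apply_bcontfun v j)"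
proof (rule continuous_onI)
  fix v :: "'a \<Rightarrow>\<^sub>C 'b" and e :: real
  assume "0 < e"
  then show "\<exists>d>0. \<forall>w\<in>S. dist w v < d \<longrightarrow> dist (apply_bcontfun w j) (apply_bcontfun v j) \<le> e"
    by (intro exI[of _ e]) (auto intro: less_imp_le dist_fun_lt_imp_dist_val_lt)
qed

lemma power2_convex_comb:
  fixes a b u v :: real
  assumes "0 \<le> u" "0 \<le> v" "u + v = 1"
  shows "(u * a + v * b)\<^sup>2 \<le> u * a\<^sup>2 + v * b\<^sup>2"
proof -
  have v: "v = 1 - u" using assms by simp
  have "u * a\<^sup>2 + v * b\<^sup>2 - (u * a + v * b)\<^sup>2 = u * v * (a - b)\<^sup>2"
    unfolding v by (simp add: power2_eq_square algebra_simps)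
  moreover have "\<dots> \<ge> 0" using assms by simp
  ultimately show ?thesis by linarith
qed

lemma convex_bcontfun_disc:
  "convex {v :: nat \<Rightarrow>\<^sub>C real. (\<Sum>i<n. (apply_bcontfun v i)\<^sup>2) \<le> 1 \<and> (\<forall>i\<ge>n. apply_bcontfun v i = 0)
     \<and> (\<forall>i<n. L i \<le> apply_bcontfun v i \<and> apply_bcontfun v i \<le> H i)}"
proof (intro convexI CollectI conjI allI impI, goal_cases)
  case (1 x y u v)
  have "(\<Sum>i<n. (u * x i + v * y i)\<^sup>2) \<le> (\<Sum>i<n. u * (x i)\<^sup>2 + v * (y i)\<^sup>2)"
    by (intro sum_mono power2_convex_comb 1)
  also have "\<dots> = u * (\<Sum>i<n. (x i)\<^sup>2) + v * (\<Sum>i<n. (y i)\<^sup>2)"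
    by (simp add: sum.distrib sum_distrib_left)
  also have "\<dots> \<le> u * 1 + v * 1"
    using 1 by (intro add_mono mult_left_mono) auto
  finally show ?case using 1 by (simp add: plus_bcontfun.rep_eq scaleR_bcontfun.rep_eq)
next
  case (2 x y u v i)
  then show ?case by (simp add: plus_bcontfun.rep_eq scaleR_bcontfun.rep_eq)
next
  case (3 x y u v i)
  have "u * L i + v * L i \<le> u * x i + v * y i" using 3 by (intro add_mono mult_left_mono) auto
  moreover have "u * L i + v * L i = L i" using 3 by (metis distrib_right mult_1)
  ultimately show ?case by (simp add: plus_bcontfun.rep_eq scaleR_bcontfun.rep_eq)
next
  case (4 x y u v i)
  have "u * x i + v * y i \<le> u * H i + v * H i" using 4 by (intro add_mono mult_left_mono) auto
  moreover have "u * H i + v * H i = H i" using 4 by (metis distrib_right mult_1)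
  ultimately show ?case by (simp add: plus_bcontfun.rep_eq scaleR_bcontfun.rep_eq)
qed

lemma sum_sq_last: "(\<Sum>i\<le>n. (x i)\<^sup>2) = (\<Sum>i<n. (x i)\<^sup>2) + (x n)\<^sup>2" for x :: "nat \<Rightarrow> real"
  by (simp add: lessThan_Suc_atMost[symmetric])

text \<open>A cell is the graph of s * sqrt (1 - |v|^2) over the intersection of the unit disc with
  a box, and that intersection is convex. Forgetting the last coordinate is therefore a
  homeomorphism, also for degenerate boxes with L i = H i, which are the faces used in
  gluing.\<close>

lemma cell_homeomorphic_convex:
  assumes s: "s\<^sup>2 = 1"
  obtains D :: "(nat \<Rightarrow>\<^sub>C real) set" and h k
  where "convex D" "homeomorphism D (cell s n L H) h k"
proof
  let ?D = "{v :: nat \<Rightarrow>\<^sub>C real. (\<Sum>i<n. (apply_bcontfun v i)\<^sup>2) \<le> 1 \<and> (\<forall>i\<ge>n. apply_bcontfun v i = 0)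
     \<and> (\<forall>i<n. L i \<le> apply_bcontfun v i \<and> apply_bcontfun v i \<le> H i)}"
  let ?h = "\<lambda>(v :: nat \<Rightarrow>\<^sub>C real) i. if i = n then s * sqrt (1 - (\<Sum>i<n. (apply_bcontfun v i)\<^sup>2)) else apply_bcontfun v i"
  let ?k = "\<lambda>x::nat \<Rightarrow> real. \<Sum>i<n. x i *\<^sub>R unit_seq i"
  show "convex ?D" by (rule convex_bcontfun_disc)
  show "homeomorphism ?D (cell s n L H) ?h ?k"
  proof (rule homeomorphismI)
    have "continuous_on ?D (\<lambda>v. ?h v i)" for i
      by (cases "i = n") (auto intro!: continuous_intros continuous_on_apply_bcontfun_at)
    then show "continuous_on ?D ?h" by (rule continuous_on_coordinatewise_then_product)
    show "continuous_on (cell s n L H) ?k"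
      by (intro continuous_intros continuous_on_subset[OF continuous_on_product_coordinates]) auto
    show "?h ` ?D \<subseteq> cell s n L H"
      using s by (auto simp: cell_def Sph_def sum_sq_last power_mult_distrib power2_eq_square[symmetric]
          mult.assoc[symmetric])
    show "?k ` cell s n L H \<subseteq> ?D"
      by (auto simp: apply_unit_seq_sum cell_def Sph_def sum_sq_last) (smt (verit) zero_le_power2)
    show "?k (?h v) = v" if "v \<in> ?D" for v
      using that by (intro bcontfun_eqI) (simp add: apply_unit_seq_sum)
    show "?h (?k x) = x" if "x \<in> cell s n L H" for x
    proof
      fix i
      have "(x n)\<^sup>2 = 1 - (\<Sum>i<n. (x i)\<^sup>2)" "0 \<le> s * x n" "\<forall>i>n. x i = 0"
        using that by (auto simp: cell_def Sph_def sum_sq_last)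
      moreover have "s * \<bar>x n\<bar> = x n"
      proof (cases "s = 1")
        case False
        then have "s = -1" using s by (simp add: power2_eq_1_iff)
        then show ?thesis using \<open>0 \<le> s * x n\<close> by simp
      qed (use \<open>0 \<le> s * x n\<close> in simp)
      ultimately show "?h (?k x) i = x i"
        by (auto simp: apply_unit_seq_sum) (metis real_sqrt_abs)
    qed
  qed
qed

lemma cell_has_logs: "s\<^sup>2 = 1 \<Longrightarrow> has_logs (cell s n L H)"
  by (metis cell_homeomorphic_convex convex_has_logs has_logs_homeomorphism)

lemma cell_connected: "s\<^sup>2 = 1 \<Longrightarrow> connected (cell s n L H)"
  by (metis cell_homeomorphic_convex convex_connected homeomorphic_connectedness homeomorphic_def)

lemma closed_Sph: "closed (Sph n)"
proof -
  have "closed {x :: nat \<Rightarrow> real. (\<Sum>i\<le>n. (x i)\<^sup>2) = 1}"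
    by (intro closed_Collect_eq continuous_intros continuous_on_product_coordinates)
  moreover have "closed {x :: nat \<Rightarrow> real. i > n \<longrightarrow> x i = 0}" for i
    by (cases "i > n") (simp_all add: closed_Collect_eq)
  ultimately show ?thesis
    unfolding Sph_def by (intro closed_Collect_conj closed_Collect_all)
qed

lemma closed_cell: "closed (cell s n L H)"
proof -
  have "closed {x :: nat \<Rightarrow> real. i < n \<longrightarrow> L i \<le> x i \<and> x i \<le> H i}" for i
    by (cases "i < n") (simp_all add: closed_Collect_conj closed_Collect_le)
  moreover have "closed {x :: nat \<Rightarrow> real. 0 \<le> s * x n}"
    by (intro closed_Collect_le continuous_intros continuous_on_product_coordinates)
  ultimately show ?thesis
    unfolding cell_def using closed_Sph by (intro closed_Collect_conj closed_Collect_all) simp_all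
qed

lemma Sph_coord_le_1: "x \<in> Sph n \<Longrightarrow> \<bar>x i\<bar> \<le> 1"
proof -
  assume x: "x \<in> Sph n"
  have "(x i)\<^sup>2 \<le> 1" 
  proof (cases "i \<le> n")
    case True
    then have "(x i)\<^sup>2 \<le> (\<Sum>i\<le>n. (x i)\<^sup>2)" by (intro member_le_sum) auto
    then show ?thesis using x by (simp add: Sph_def)
  qed (use x in \<open>auto simp: Sph_def\<close>)
  then show ?thesis by (simp add: abs_square_le_1)
qed

lemma Sph_eq_Un_cells: "Sph n = cell 1 n (\<lambda>_. -1) (\<lambda>_. 1) \<union> cell (-1) n (\<lambda>_. -1) (\<lambda>_. 1)"
  using Sph_coord_le_1 by (force simp: cell_def abs_le_iff)

lemma cells_Int_equator:
  "cell 1 n (\<lambda>_. -1) (\<lambda>_. 1) \<inter> cell (-1) n (\<lambda>_. -1) (\<lambda>_. 1) = {x \<in> Sph n. x n = 0}"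
  using Sph_coord_le_1 by (force simp: cell_def abs_le_iff)

lemma Sph_equator: "{x \<in> Sph (Suc n). x (Suc n) = 0} = Sph n"
  unfolding Sph_def using Suc_lessI [of n] by (fastforce simp: set_eq_iff)

lemma Sph_equator_0: "{x \<in> Sph 0. x 0 = 0} = {}"
  by (auto simp: Sph_def)

lemma Sph_nonempty: "(\<lambda>i. if i = 0 then 1 else 0) \<in> Sph n"
  using in_topspace_nsphere[of n] by (simp add: nsphere_eq_top_of_set)

lemma connected_Sph: "connected (Sph (Suc n))"
  unfolding Sph_eq_Un_cells [of "Suc n"]
  by (rule connected_Un) (use Sph_nonempty in \<open>auto simp: cells_Int_equator Sph_equator cell_connected\<close>)

text \<open>The hemispheres meet in a sphere of one dimension less. It is disconnected only when it
  consists of two points, which is the excluded case; for n = 0 it is empty and so counts as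
  connected.\<close>

lemma has_logs_Sph:
  assumes "n \<noteq> 1" shows "has_logs (Sph n)"
proof -
  have "connected {x \<in> Sph n. x n = 0}"
  proof (cases n)
    case (Suc m)
    then show ?thesis using assms connected_Sph[of "m - 1"] by (simp add: Sph_equator)
  qed (simp add: Sph_equator_0)
  then have "connected (cell 1 n (\<lambda>_. -1) (\<lambda>_. 1) \<inter> cell (-1) n (\<lambda>_. -1) (\<lambda>_. 1))"
    by (simp only: cells_Int_equator)
  then show ?thesis
    unfolding Sph_eq_Un_cells [of n]
    by (intro has_logs_Un) (auto simp: cell_has_logs closed_cell closed_subset)
qed

lemma compact_Sph: "compact (Sph n)"
proof -
  have "compact_space (product_topology (\<lambda>i. top_of_set {-1..1::real}) (UNIV::nat set))"
    by (simp add: compact_space_product_topology compact_space_subtopology)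
  then have "compactin euclidean (PiE UNIV (\<lambda>i::nat. {-1..1::real}))"
    using compactin_PiE[of "\<lambda>i::nat. euclideanreal" UNIV "\<lambda>i. {-1..1}"]
    by (simp add: euclidean_product_topology)
  then have "compact (PiE UNIV (\<lambda>i::nat. {-1..1::real}))" by simp
  moreover have "Sph n \<subseteq> PiE UNIV (\<lambda>i::nat. {-1..1::real})"
    using Sph_coord_le_1 by (force simp: abs_le_iff)
  ultimately show ?thesis using closed_Sph
    by (metis closed_Int_compact inf.absorb1)
qed

section \<open>Plane bundles\<close>

lemma continuous_map_locallyI:
  assumes "\<And>x. x \<in> topspace X \<Longrightarrow> \<exists>T. openin X T \<and> x \<in> T \<and> continuous_map (subtopology X T) Y f"
  shows "continuous_map X Y f"
proof -
  obtain T where T: "\<And>x. x \<in> topspace X \<Longrightarrow> openin X (T x) \<and> x \<in> T x \<and> continuous_map (subtopology X (T x)) Y f"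
    using assms by metis
  show ?thesis
    by (rule pasting_lemma [where I = "topspace X" and T = T and f = "\<lambda>_. f"]) (use T in auto)
qed

lemma continuous_on_locallyI:
  assumes "\<And>x. x \<in> S \<Longrightarrow> \<exists>T. openin (top_of_set S) T \<and> x \<in> T \<and> continuous_on T f"
  shows "continuous_on S f"
proof -
  have "continuous_map (top_of_set S) euclidean f"
  proof (rule continuous_map_locallyI)
    fix x assume "x \<in> topspace (top_of_set S)"
    then obtain T where T: "openin (top_of_set S) T" "x \<in> T" "continuous_on T f" using assms by auto
    moreover have "S \<inter> T = T" using T openin_imp_subset by blast
    ultimately show "\<exists>T. openin (top_of_set S) T \<and> x \<in> T \<and>
        continuous_map (subtopology (top_of_set S) T) euclidean f"
      by (auto simp: subtopology_subtopology)
  qed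
  then show ?thesis by simp
qed

text \<open>Every real-linear self-map of the plane has this form, with determinant |\<alpha>|^2 -
  |\<beta>|^2. The inverse is the adjugate map divided by the determinant.\<close>

lemma bij_complex_real_linear:
  fixes \<alpha> \<beta> :: complex
  assumes "cmod \<alpha> \<noteq> cmod \<beta>"
  shows "bij (\<lambda>z. \<alpha> * z + \<beta> * cnj z)"
proof -
  let ?d = "\<alpha> * cnj \<alpha> - \<beta> * cnj \<beta>"
  have d: "?d \<noteq> 0"
    using assms by (simp add: complex_norm_square[symmetric] flip: of_real_power of_real_diff)
  show ?thesis
  proof (rule bij_betw_byWitness [where f' = "\<lambda>w. (cnj \<alpha> * w - \<beta> * cnj w) / ?d"])
    show "\<forall>z\<in>UNIV. (cnj \<alpha> * (\<alpha> * z + \<beta> * cnj z) - \<beta> * cnj (\<alpha> * z + \<beta> * cnj z)) / ?d = z"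
      using d by (auto simp: field_simps)
    have cd: "cnj ?d = ?d" by (simp add: mult.commute)
    have "\<alpha> * ((cnj \<alpha> * w - \<beta> * cnj w) / ?d) + \<beta> * cnj ((cnj \<alpha> * w - \<beta> * cnj w) / ?d) = w" for w
    proof -
      have "\<alpha> * (cnj \<alpha> * w - \<beta> * cnj w) + \<beta> * cnj (cnj \<alpha> * w - \<beta> * cnj w) = w * ?d"
        by (simp add: algebra_simps)
      then show ?thesis
        unfolding complex_cnj_divide cd times_divide_eq_right add_divide_distrib[symmetric] using d by simp
    qed
    then show "\<forall>w\<in>UNIV. \<alpha> * ((cnj \<alpha> * w - \<beta> * cnj w) / ?d) + \<beta> * cnj ((cnj \<alpha> * w - \<beta> * cnj w) / ?d) = w"
      by blast
  qed auto
qed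

text \<open>When the determinant vanishes, the adjugate t \<mapsto> cnj \<alpha> * t - \<beta> * cnj
  t takes values in the kernel. Up to sign the two candidates are its values at 1 and \<i>; both
  vanish only if \<alpha> = 0.\<close>

lemma complex_real_linear_kernel:
  fixes \<alpha> \<beta> :: complex
  assumes "cmod \<alpha> = cmod \<beta>"
  shows "\<exists>z. z \<noteq> 0 \<and> \<alpha> * z + \<beta> * cnj z = 0"
proof (cases "\<alpha> = 0")
  case True
  then show ?thesis using assms by (intro exI[of _ 1]) simp
next
  case False
  have e: "\<alpha> * cnj \<alpha> = \<beta> * cnj \<beta>"
    using assms by (simp add: complex_norm_square[symmetric])
  have 1: "\<alpha> * (\<beta> - cnj \<alpha>) + \<beta> * cnj (\<beta> - cnj \<alpha>) = 0"
    using e by (simp add: algebra_simps)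
  have 2: "\<alpha> * (\<i> * (\<beta> + cnj \<alpha>)) + \<beta> * cnj (\<i> * (\<beta> + cnj \<alpha>)) = 0"
    using e by (simp add: algebra_simps)
  have "\<beta> - cnj \<alpha> \<noteq> 0 \<or> \<i> * (\<beta> + cnj \<alpha>) \<noteq> 0"
  proof (rule ccontr)
    assume "\<not> ?thesis"
    then have "\<beta> = cnj \<alpha>" "\<beta> = - cnj \<alpha>" by (auto simp: add_eq_0_iff2)
    then show False using False by simp
  qed
  then show ?thesis using 1 2 by blast
qed

lemma connected_nonzero_sign:
  fixes d :: "'b::topological_space \<Rightarrow> real"
  assumes "connected K" "continuous_on K d" "\<And>x. x \<in> K \<Longrightarrow> d x \<noteq> 0"
  shows "(\<forall>x\<in>K. 0 < d x) \<or> (\<forall>x\<in>K. d x < 0)"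
proof (rule ccontr)
  assume "\<not> ?thesis"
  then obtain x y where xy: "x \<in> K" "y \<in> K" "d x < 0" "0 < d y"
    using assms(3) by (meson linorder_neqE_linordered_idom)
  have "connected (d ` K)" using assms connected_continuous_image by blast
  then have "0 \<in> d ` K"
    using xy connected_contains_Icc[of "d ` K" "d x" "d y"] by fastforce
  then show False using assms(3) by force
qed

text \<open>A chart is stored as its fibre coordinate H and its inverse \<Psi>, the base coordinate
  being p itself. Complex fibres let transition maps be written with multiplication and conjugation.
  The base is a set in a second countable metric space so that Tietze extension applies.\<close>

locale plane_bundle =
  fixes E :: "'a topology" and B :: "'b::{metric_space,second_countable_topology} set"
    and p :: "'a \<Rightarrow> 'b" and add :: "'a \<Rightarrow> 'a \<Rightarrow> 'a" and scale :: "real \<Rightarrow> 'a \<Rightarrow> 'a"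
  assumes cont_p: "continuous_map E (top_of_set B) p"
    and add_closed: "\<And>x y. \<lbrakk>x \<in> topspace E; y \<in> topspace E; p y = p x\<rbrakk> \<Longrightarrow> add x y \<in> topspace E \<and> p (add x y) = p x"
    and scale_closed: "\<And>c x. x \<in> topspace E \<Longrightarrow> scale c x \<in> topspace E \<and> p (scale c x) = p x"
    and charts: "\<And>b. b \<in> B \<Longrightarrow> \<exists>U H \<Psi>. openin (top_of_set B) U \<and> b \<in> U \<and>
      continuous_map (subtopology E {e \<in> topspace E. p e \<in> U}) euclidean (H :: 'a \<Rightarrow> complex) \<and>
      continuous_map (prod_topology (top_of_set U) euclidean) E \<Psi> \<and>
      (\<forall>u\<in>U. \<forall>z. p (\<Psi> (u, z)) = u \<and> H (\<Psi> (u, z)) = z) \<and>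
      (\<forall>e\<in>topspace E. p e \<in> U \<longrightarrow> \<Psi> (p e, H e) = e) \<and>
      (\<forall>x\<in>topspace E. \<forall>y\<in>topspace E. p x \<in> U \<and> p y = p x \<longrightarrow> H (add x y) = H x + H y) \<and>
      (\<forall>x\<in>topspace E. \<forall>c. p x \<in> U \<longrightarrow> H (scale c x) = c *\<^sub>R H x)"
begin

definition fibre :: "'b \<Rightarrow> 'a set" where
  "fibre b = {e \<in> topspace E. p e = b}"

definition is_lin :: "'b \<Rightarrow> ('a \<Rightarrow> complex) \<Rightarrow> bool" where
  "is_lin b F \<longleftrightarrow> (\<forall>x\<in>fibre b. \<forall>y\<in>fibre b. F (add x y) = F x + F y) \<and>
     (\<forall>x\<in>fibre b. \<forall>c. F (scale c x) = c *\<^sub>R F x) \<and> bij_betw F (fibre b) UNIV"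

text \<open>Only the fibre coordinate is recorded, over an arbitrary subset of the base, which makes
  restriction and pasting easy. Continuity of the inverse is recovered from the charts in
  \<open>trivialization_inverse\<close>.\<close>

definition trivialization :: "'b set \<Rightarrow> ('a \<Rightarrow> complex) \<Rightarrow> bool" where
  "trivialization A F \<longleftrightarrow> A \<subseteq> B \<and>
     continuous_map (subtopology E {e \<in> topspace E. p e \<in> A}) euclidean F \<and> (\<forall>b\<in>A. is_lin b F)"

lemma add_fibre: "x \<in> fibre b \<Longrightarrow> y \<in> fibre b \<Longrightarrow> add x y \<in> fibre b"
  using add_closed by (simp add: fibre_def)

lemma scale_fibre: "x \<in> fibre b \<Longrightarrow> scale c x \<in> fibre b"
  using scale_closed by (simp add: fibre_def)

lemma is_lin_cong: "is_lin b F \<Longrightarrow> (\<And>x. x \<in> fibre b \<Longrightarrow> F' x = F x) \<Longrightarrow> is_lin b F'"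
  using bij_betw_cong[of "fibre b" F' F UNIV] unfolding is_lin_def by (simp add: add_fibre scale_fibre)

lemma is_lin_surj: "is_lin b G \<Longrightarrow> \<exists>x. x \<in> fibre b \<and> G x = z"
  unfolding is_lin_def bij_betw_def by (metis UNIV_I imageE)

lemma is_lin_inj: "\<lbrakk>is_lin b G; x \<in> fibre b; y \<in> fibre b; G x = G y\<rbrakk> \<Longrightarrow> x = y"
  unfolding is_lin_def bij_betw_def by (simp add: inj_on_def)

lemma is_lin_real_linear:
  assumes "is_lin b G" "cmod \<alpha> \<noteq> cmod \<beta>"
  shows "is_lin b (\<lambda>x. \<alpha> * G x + \<beta> * cnj (G x))"
proof -
  have "bij_betw ((\<lambda>z. \<alpha> * z + \<beta> * cnj z) \<circ> G) (fibre b) UNIV"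
    using assms bij_complex_real_linear by (auto simp: is_lin_def intro: bij_betw_trans)
  then show ?thesis
    using assms(1) by (simp add: is_lin_def o_def algebra_simps)
qed

text \<open>In the coordinate G, F is a real-linear map T of the plane. From T 1 = \<alpha> +
  \<beta> and T \<i> = \<i> * (\<alpha> - \<beta>) come the formulas for \<alpha> and \<beta>; equal
  moduli would give a kernel vector and contradict injectivity of F.\<close>

lemma is_lin_coeffs:
  assumes F: "is_lin b F" and G: "is_lin b G"
  shows "\<exists>\<alpha> \<beta>. cmod \<alpha> \<noteq> cmod \<beta> \<and> (\<forall>x\<in>fibre b. F x = \<alpha> * G x + \<beta> * cnj (G x))"
proof -
  obtain v w where v: "v \<in> fibre b" "G v = 1" and w: "w \<in> fibre b" "G w = \<i>"
    using is_lin_surj[OF G] by metis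
  define \<alpha> \<beta> where "\<alpha> = (F v - \<i> * F w) / 2" and "\<beta> = (F v + \<i> * F w) / 2"
  have eq: "F x = \<alpha> * G x + \<beta> * cnj (G x)" if x: "x \<in> fibre b" for x
  proof -
    let ?y = "add (scale (Re (G x)) v) (scale (Im (G x)) w)"
    have y: "?y \<in> fibre b" using v w by (simp add: add_fibre scale_fibre)
    have "G ?y = G x"
      using G v w by (simp add: is_lin_def scale_fibre complex_eq_iff)
    then have "x = ?y" using is_lin_inj[OF G x y] by simp
    then have "F x = F ?y" by simp
    also have "\<dots> = Re (G x) *\<^sub>R F v + Im (G x) *\<^sub>R F w"
      using F v w by (simp add: is_lin_def scale_fibre)
    also have "\<dots> = \<alpha> * G x + \<beta> * cnj (G x)"
      by (simp add: \<alpha>_def \<beta>_def complex_eq_iff algebra_simps field_simps)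
    finally show ?thesis .
  qed
  have "cmod \<alpha> \<noteq> cmod \<beta>"
  proof
    assume "cmod \<alpha> = cmod \<beta>"
    then obtain z where z: "z \<noteq> 0" "\<alpha> * z + \<beta> * cnj z = 0" using complex_real_linear_kernel by blast
    obtain x where x: "x \<in> fibre b" "G x = z" using is_lin_surj[OF G] by metis
    obtain x0 where x0: "x0 \<in> fibre b" "G x0 = 0" using is_lin_surj[OF G] by metis
    have "F x = F x0" using eq[OF x(1)] eq[OF x0(1)] x x0 z by simp
    then have "x = x0" using is_lin_inj[OF F] x x0 by blast
    then show False using x x0 z by simp
  qed
  then show ?thesis using eq by blast
qed

lemma trivialization_subset:
  assumes "trivialization A F" "C \<subseteq> A" shows "trivialization C F"
  using assms unfolding trivialization_def
  by (auto elim!: continuous_map_from_subtopology_mono)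

lemma chartE:
  assumes "b \<in> B"
  obtains U H \<Psi> where "openin (top_of_set B) U" "b \<in> U" "trivialization U H"
    "continuous_map (prod_topology (top_of_set U) euclidean) E \<Psi>"
    "\<And>u z. u \<in> U \<Longrightarrow> \<Psi> (u, z) \<in> fibre u \<and> H (\<Psi> (u, z)) = z"
    "\<And>e. e \<in> topspace E \<Longrightarrow> p e \<in> U \<Longrightarrow> \<Psi> (p e, H e) = e"
proof -
  obtain U H \<Psi> where U: "openin (top_of_set B) U" "b \<in> U"
    and H: "continuous_map (subtopology E {e \<in> topspace E. p e \<in> U}) euclidean (H :: 'a \<Rightarrow> complex)"
    and \<Psi>: "continuous_map (prod_topology (top_of_set U) euclidean) E \<Psi>"
    and inv: "\<forall>u\<in>U. \<forall>z. p (\<Psi> (u, z)) = u \<and> H (\<Psi> (u, z)) = z"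
       "\<forall>e\<in>topspace E. p e \<in> U \<longrightarrow> \<Psi> (p e, H e) = e"
    and lin: "\<forall>x\<in>topspace E. \<forall>y\<in>topspace E. p x \<in> U \<and> p y = p x \<longrightarrow> H (add x y) = H x + H y"
       "\<forall>x\<in>topspace E. \<forall>c. p x \<in> U \<longrightarrow> H (scale c x) = c *\<^sub>R H x"
    using charts[OF assms] by (elim exE conjE) (rule that, assumption+)
  have fib: "\<Psi> (u, z) \<in> fibre u" if "u \<in> U" for u z
    using \<Psi> inv(1) that by (auto simp: fibre_def continuous_map_def Pi_iff)
  have "is_lin u H" if u: "u \<in> U" for u
    unfolding is_lin_def
  proof (intro conjI ballI allI)
    show "bij_betw H (fibre u) UNIV"
      by (rule bij_betw_byWitness[where f' = "\<lambda>z. \<Psi> (u, z)"])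
         (use u inv fib in \<open>auto simp: fibre_def\<close>)
  qed (use u lin in \<open>auto simp: fibre_def\<close>)
  moreover have "U \<subseteq> B" using U openin_imp_subset by blast
  ultimately have "trivialization U H" using H by (simp add: trivialization_def)
  then show ?thesis using that U \<Psi> inv fib by blast
qed

lemma continuous_on_trivialization_section:
  assumes F: "trivialization C F" and "U \<subseteq> B"
    and \<Psi>: "continuous_map (prod_topology (top_of_set U) euclidean) E \<Psi>"
    and fib: "\<And>u z. u \<in> U \<Longrightarrow> \<Psi> (u, z) \<in> fibre u"
  shows "continuous_on (C \<inter> U) (\<lambda>u. F (\<Psi> (u, z :: complex)))"
proof -
  have "continuous_map (top_of_set (C \<inter> U)) (prod_topology (top_of_set U) euclidean) (\<lambda>u. (u, z))"
    by (intro continuous_map_pairedI) auto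
  then have "continuous_map (top_of_set (C \<inter> U)) E (\<Psi> \<circ> (\<lambda>u. (u, z)))"
    using \<Psi> by (rule continuous_map_compose)
  then have "continuous_map (top_of_set (C \<inter> U)) (subtopology E {e \<in> topspace E. p e \<in> C}) (\<Psi> \<circ> (\<lambda>u. (u, z)))"
    using fib by (auto simp: continuous_map_in_subtopology fibre_def)
  then have "continuous_map (top_of_set (C \<inter> U)) euclidean (F \<circ> (\<Psi> \<circ> (\<lambda>u. (u, z))))"
    using F unfolding trivialization_def by (blast intro: continuous_map_compose)
  then show ?thesis by (simp add: o_def)
qed

text \<open>Over a chart the sections \<Psi> (u, 1) and \<Psi> (u, \<i>) form a continuous frame.
  Evaluating the relation between F and G on it gives two linear equations for the coefficients, and
  Cramer's rule writes them as quotients of continuous functions.\<close>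

lemma transition_continuous:
  assumes F: "trivialization C F" and G: "trivialization C G"
  shows "\<exists>\<alpha> \<beta>. continuous_on C \<alpha> \<and> continuous_on C \<beta> \<and>
    (\<forall>b\<in>C. cmod (\<alpha> b) \<noteq> cmod (\<beta> b) \<and> (\<forall>x\<in>fibre b. F x = \<alpha> b * G x + \<beta> b * cnj (G x)))"
proof -
  have "\<forall>b\<in>C. \<exists>\<alpha> \<beta>. cmod \<alpha> \<noteq> cmod \<beta> \<and> (\<forall>x\<in>fibre b. F x = \<alpha> * G x + \<beta> * cnj (G x))"
    using F G is_lin_coeffs by (simp add: trivialization_def)
  then obtain \<alpha> \<beta> where ab: "\<And>b. b \<in> C \<Longrightarrow> cmod (\<alpha> b) \<noteq> cmod (\<beta> b)"
      "\<And>b x. b \<in> C \<Longrightarrow> x \<in> fibre b \<Longrightarrow> F x = \<alpha> b * G x + \<beta> b * cnj (G x)"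
    by metis
  have loc: "\<exists>T. openin (top_of_set C) T \<and> b \<in> T \<and> continuous_on T \<alpha> \<and> continuous_on T \<beta>" if b: "b \<in> C" for b
  proof -
    have "b \<in> B" using b F by (auto simp: trivialization_def)
    then obtain U H \<Psi> where U: "openin (top_of_set B) U" "b \<in> U" and H: "trivialization U H"
      and \<Psi>: "continuous_map (prod_topology (top_of_set U) euclidean) E \<Psi>"
      and fib: "\<And>u z. u \<in> U \<Longrightarrow> \<Psi> (u, z) \<in> fibre u \<and> H (\<Psi> (u, z)) = z"
      by (rule chartE) blast
    have UB: "U \<subseteq> B" and CB: "C \<subseteq> B" using H F by (auto simp: trivialization_def)
    have cont: "continuous_on (C \<inter> U) (\<lambda>u. F (\<Psi> (u, z)))" "continuous_on (C \<inter> U) (\<lambda>u. G (\<Psi> (u, z)))" for z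
      using continuous_on_trivialization_section[OF _ UB \<Psi>] F G fib by auto
    \<comment> \<open>The determinant of that system; in the coefficients c, d of G relative to the
      chart it is -2 \<i> (|c|^2 - |d|^2), hence nonzero.\<close>
    define D where "D u = G (\<Psi> (u, 1)) * cnj (G (\<Psi> (u, \<i>))) - G (\<Psi> (u, \<i>)) * cnj (G (\<Psi> (u, 1)))" for u
    have D: "D u \<noteq> 0" if u: "u \<in> C \<inter> U" for u
    proof -
      obtain c d where cd: "cmod c \<noteq> cmod d" "\<And>x. x \<in> fibre u \<Longrightarrow> G x = c * H x + d * cnj (H x)"
        using is_lin_coeffs[of u G H] G H u by (auto simp: trivialization_def)
      then have "D u = - 2 * \<i> * (c * cnj c - d * cnj d)"
        using fib u by (simp add: D_def algebra_simps)
      also have "\<dots> = - 2 * \<i> * of_real ((cmod c)\<^sup>2 - (cmod d)\<^sup>2)"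
        by (simp add: complex_norm_square[symmetric])
      also have "\<dots> \<noteq> 0" using cd(1) by (simp flip: of_real_power of_real_diff)
      finally show ?thesis .
    qed
    have F: "F (\<Psi> (u, z)) = \<alpha> u * G (\<Psi> (u, z)) + \<beta> u * cnj (G (\<Psi> (u, z)))" if "u \<in> C \<inter> U" for u z
      using ab(2) fib that by blast
    have "\<alpha> u = (F (\<Psi> (u, 1)) * cnj (G (\<Psi> (u, \<i>))) - F (\<Psi> (u, \<i>)) * cnj (G (\<Psi> (u, 1)))) / D u"
      and "\<beta> u = (G (\<Psi> (u, 1)) * F (\<Psi> (u, \<i>)) - G (\<Psi> (u, \<i>)) * F (\<Psi> (u, 1))) / D u" if "u \<in> C \<inter> U" for u
      using D[OF that] unfolding F[OF that]
      by (simp_all add: nonzero_eq_divide_eq) (simp_all add: D_def algebra_simps)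
    note coeffs = this
    have "continuous_on (C \<inter> U)
        (\<lambda>u. (F (\<Psi> (u, 1)) * cnj (G (\<Psi> (u, \<i>))) - F (\<Psi> (u, \<i>)) * cnj (G (\<Psi> (u, 1)))) / D u)"
      "continuous_on (C \<inter> U)
        (\<lambda>u. (G (\<Psi> (u, 1)) * F (\<Psi> (u, \<i>)) - G (\<Psi> (u, \<i>)) * F (\<Psi> (u, 1))) / D u)"
      using D by (auto simp: D_def intro!: continuous_intros cont)
    note conts = this
    have "continuous_on (C \<inter> U) \<alpha>" "continuous_on (C \<inter> U) \<beta>"
      by (rule continuous_on_eq[OF conts(1)], simp only: coeffs(1), rule continuous_on_eq[OF conts(2)], simp only: coeffs(2))
    moreover have "openin (top_of_set C) (C \<inter> U)"
      using U(1) CB by (auto simp: openin_open)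
    ultimately show ?thesis using b U by blast
  qed
  have "continuous_on C \<alpha>" "continuous_on C \<beta>"
    using loc by (meson continuous_on_locallyI)+
  then show ?thesis using ab by auto
qed

text \<open>The transition function is the map \<open>z \<mapsto> \<alpha> z + \<beta> cnj z\<close>. Tietze extends a logarithm of
  \<open>\<alpha>\<close> and the ratio \<open>\<beta> / \<alpha>\<close>, which takes values in the open unit disc, and thereby the transition
  function itself, to the whole base.\<close>

lemma trivialization_glue_aux:
  assumes A: "trivialization A F" "closedin (top_of_set B) A"
    and C: "trivialization C G" "closedin (top_of_set B) C"
    and logs: "has_logs (A \<inter> C)"
    and \<alpha>: "continuous_on (A \<inter> C) \<alpha>" and \<beta>: "continuous_on (A \<inter> C) \<beta>"
    and less: "\<And>b. b \<in> A \<inter> C \<Longrightarrow> cmod (\<beta> b) < cmod (\<alpha> b)"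
    and eq: "\<And>b x. b \<in> A \<inter> C \<Longrightarrow> x \<in> fibre b \<Longrightarrow> F x = \<alpha> b * G x + \<beta> b * cnj (G x)"
  shows "\<exists>F'. trivialization (A \<union> C) F'"
proof -
  let ?K = "A \<inter> C"
  have nz: "\<alpha> b \<noteq> 0" if "b \<in> ?K" for b using less[OF that] by auto
  obtain h where h: "continuous_on ?K h" "\<And>b. b \<in> ?K \<Longrightarrow> \<alpha> b = exp (h b)"
    using has_logsE[OF logs \<alpha> nz] by blast
  define r where "r b = cmod (\<beta> b / \<alpha> b)" for b
  \<comment> \<open>The radial map w \<mapsto> w / sqrt (1 - |w|^2) carries the open unit disc onto
    the plane, where Tietze has no bound to respect. Its inverse, used for \<open>\<gamma>\<close>,
    brings the extension back strictly inside the disc.\<close>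
  define \<kappa> where "\<kappa> b = (\<beta> b / \<alpha> b) / of_real (sqrt (1 - (r b)\<^sup>2))" for b
  have r: "0 \<le> r b" "r b < 1" "(r b)\<^sup>2 < 1" if "b \<in> ?K" for b
    using less[OF that] nz[OF that] by (auto simp: r_def norm_divide abs_square_less_1)
  have K: "closedin (top_of_set B) ?K" using A C by blast
  have "continuous_on ?K \<kappa>"
    unfolding \<kappa>_def r_def using nz r by (intro continuous_intros \<alpha> \<beta>) (force simp: r_def)+
  then obtain \<kappa>' where \<kappa>': "continuous_on B \<kappa>'" "\<And>b. b \<in> ?K \<Longrightarrow> \<kappa>' b = \<kappa> b"
    using Tietze_unbounded[OF _ K] by metis
  obtain h' where h': "continuous_on B h'" "\<And>b. b \<in> ?K \<Longrightarrow> h' b = h b"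
    using Tietze_unbounded[OF h(1) K] by metis
  define \<gamma> where "\<gamma> b = \<kappa>' b / of_real (sqrt (1 + (cmod (\<kappa>' b))\<^sup>2))" for b
  have pos: "0 < 1 + (cmod z)\<^sup>2" for z by (simp add: add_pos_nonneg)
  have cont_\<gamma>: "continuous_on B \<gamma>"
    unfolding \<gamma>_def using pos by (intro continuous_intros \<kappa>') (simp add: less_imp_neq[THEN not_sym])
  have \<gamma>_less: "cmod (\<gamma> b) < 1" for b
  proof -
    have "cmod (\<kappa>' b) < sqrt (1 + (cmod (\<kappa>' b))\<^sup>2)" by (rule real_less_rsqrt) simp
    then show ?thesis using pos[of "\<kappa>' b"] by (simp add: \<gamma>_def norm_divide)
  qed
  have \<gamma>_eq: "\<gamma> b = \<beta> b / \<alpha> b" if b: "b \<in> ?K" for b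
  proof -
    have s: "0 < 1 - (r b)\<^sup>2" using r[OF b] by simp
    have "cmod (\<kappa> b) = r b / sqrt (1 - (r b)\<^sup>2)"
      unfolding \<kappa>_def by (subst norm_divide) (use s in \<open>simp add: r_def\<close>)
    then have "(cmod (\<kappa> b))\<^sup>2 = (r b)\<^sup>2 / (1 - (r b)\<^sup>2)"
      using s by (simp add: power_divide)
    then have "1 + (cmod (\<kappa> b))\<^sup>2 = 1 / (1 - (r b)\<^sup>2)" using s by (simp add: field_simps)
    then have "sqrt (1 + (cmod (\<kappa> b))\<^sup>2) = 1 / sqrt (1 - (r b)\<^sup>2)" by (simp add: real_sqrt_divide)
    then show ?thesis using s by (simp add: \<gamma>_def \<kappa>'(2)[OF b]) (simp add: \<kappa>_def)
  qed
  \<comment> \<open>The extended transition map applied to G: still a fibrewise isomorphism because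
    |\<gamma>| < 1 everywhere, and equal to F over the overlap.\<close>
  define G' where "G' e = exp (h' (p e)) * (G e + \<gamma> (p e) * cnj (G e))" for e
  have G'_lin: "is_lin b G'" if b: "b \<in> C" for b
  proof (rule is_lin_cong[OF is_lin_real_linear[of b G "exp (h' b)" "exp (h' b) * \<gamma> b"]])
    show "is_lin b G" using b C by (simp add: trivialization_def)
    show "cmod (exp (h' b)) \<noteq> cmod (exp (h' b) * \<gamma> b)" using \<gamma>_less[of b] by (simp add: norm_mult)
  qed (simp add: G'_def fibre_def algebra_simps)
  have F_eq: "F e = G' e" if "e \<in> topspace E" "p e \<in> ?K" for e
    using eq[OF that(2), of e] that nz[OF that(2)] h(2)[OF that(2)]
    by (simp add: G'_def \<gamma>_eq h' fibre_def algebra_simps)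
  have pC: "continuous_map (subtopology E {e \<in> topspace E. p e \<in> C}) (top_of_set B) p"
    using cont_p continuous_map_from_subtopology by blast
  have "continuous_map (subtopology E {e \<in> topspace E. p e \<in> C}) euclidean G'"
  proof -
    have "continuous_on (B \<times> UNIV) (\<lambda>(b, z). exp (h' b) * (z + \<gamma> b * cnj z))"
      unfolding case_prod_unfold
      by (intro continuous_intros continuous_on_compose2[OF h'(1)] continuous_on_compose2[OF cont_\<gamma>]) auto
    moreover have "prod_topology (top_of_set B) (euclidean :: complex topology) = top_of_set (B \<times> UNIV)"
      using prod_topology_subtopology_eu[of B "UNIV :: complex set"] by simp
    moreover have "continuous_map (subtopology E {e \<in> topspace E. p e \<in> C}) (prod_topology (top_of_set B) euclidean) (\<lambda>e. (p e, G e))"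
      using pC C by (intro continuous_map_pairedI) (auto simp: trivialization_def)
    ultimately show ?thesis
      using continuous_map_compose[of _ "top_of_set (B \<times> (UNIV :: complex set))" "\<lambda>e. (p e, G e)" euclidean
        "\<lambda>(b, z). exp (h' b) * (z + \<gamma> b * cnj z)"]
      by (simp add: o_def G'_def[abs_def])
  qed
  note G'_cont = this
  let ?X = "subtopology E {e \<in> topspace E. p e \<in> A \<union> C}"
  define F' where "F' e = (if p e \<in> A then F e else G' e)" for e
  have clo: "closedin ?X {e \<in> topspace E. p e \<in> D}" if "closedin (top_of_set B) D" "D \<subseteq> A \<union> C" for D
    using closedin_continuous_map_preimage[OF cont_p that(1)] that(2)
    by (auto intro!: closedin_subset_topspace)
  have sub: "subtopology ?X {e \<in> topspace E. p e \<in> D} = subtopology E {e \<in> topspace E. p e \<in> D}"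
    if "D \<subseteq> A \<union> C" for D
    using that by (auto simp: subtopology_subtopology intro!: arg_cong[of _ _ "subtopology E"])
  have "continuous_map ?X euclidean F'"
  proof (rule pasting_lemma_closed)
    show "finite {True, False}" by simp
    show "closedin ?X (if i then {e \<in> topspace E. p e \<in> A} else {e \<in> topspace E. p e \<in> C})" for i
      using clo A C by simp
    show "continuous_map (subtopology ?X (if i then {e \<in> topspace E. p e \<in> A} else {e \<in> topspace E. p e \<in> C}))
        euclidean (if i then F else G')" for i
      using sub[of A] sub[of C] A(1) G'_cont by (simp add: trivialization_def)
    show "\<exists>i. i \<in> {True, False} \<and> x \<in> (if i then {e \<in> topspace E. p e \<in> A} else {e \<in> topspace E. p e \<in> C}) \<and>
        F' x = (if i then F else G') x" if "x \<in> topspace ?X" for x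
      by (rule exI[of _ "p x \<in> A"]) (use that in \<open>auto simp: F'_def\<close>)
  qed (use F_eq in \<open>auto split: if_splits\<close>)
  moreover have "is_lin b F'" if b: "b \<in> A \<union> C" for b
  proof (cases "b \<in> A")
    case True
    then have "is_lin b F" using A by (simp add: trivialization_def)
    then show ?thesis by (rule is_lin_cong) (use True in \<open>simp add: F'_def fibre_def\<close>)
  next
    case False
    then have "is_lin b G'" using b G'_lin by simp
    then show ?thesis by (rule is_lin_cong) (use False in \<open>simp add: F'_def fibre_def\<close>)
  qed
  ultimately have "trivialization (A \<union> C) F'"
    using A C by (simp add: trivialization_def)
  then show ?thesis by (rule exI[of _ F'])
qed

text \<open>The sign of |\<alpha>| - |\<beta>| says whether the transition map preserves orientation
  and is constant on the connected overlap. If it is negative, replacing G by its conjugate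
  exchanges \<alpha> and \<beta>.\<close>

lemma trivialization_glue:
  assumes A: "trivialization A F" "closedin (top_of_set B) A"
    and C: "trivialization C G" "closedin (top_of_set B) C"
    and con: "connected (A \<inter> C)" and logs: "has_logs (A \<inter> C)"
  shows "\<exists>F'. trivialization (A \<union> C) F'"
proof -
  obtain \<alpha> \<beta> where ab: "continuous_on (A \<inter> C) \<alpha>" "continuous_on (A \<inter> C) \<beta>"
    and ne: "\<And>b. b \<in> A \<inter> C \<Longrightarrow> cmod (\<alpha> b) \<noteq> cmod (\<beta> b)"
    and eq: "\<And>b x. b \<in> A \<inter> C \<Longrightarrow> x \<in> fibre b \<Longrightarrow> F x = \<alpha> b * G x + \<beta> b * cnj (G x)"
    using transition_continuous[of "A \<inter> C" F G] trivialization_subset[OF A(1)] trivialization_subset[OF C(1)]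
    by auto
  consider "\<forall>b\<in>A \<inter> C. 0 < cmod (\<alpha> b) - cmod (\<beta> b)" | "\<forall>b\<in>A \<inter> C. cmod (\<alpha> b) - cmod (\<beta> b) < 0"
    using connected_nonzero_sign[OF con, of "\<lambda>b. cmod (\<alpha> b) - cmod (\<beta> b)"] ab ne
    by (force intro!: continuous_intros)
  then show ?thesis
  proof cases
    case 1
    then show ?thesis using trivialization_glue_aux[OF A C logs ab] eq by auto
  next
    case 2
    have "is_lin b (\<lambda>e. cnj (G e))" if "b \<in> C" for b
      using is_lin_real_linear[of b G 0 1] C that by (simp add: trivialization_def)
    moreover have "continuous_map (subtopology E {e \<in> topspace E. p e \<in> C}) euclidean (cnj \<circ> G)"
      using C by (intro continuous_map_compose[of _ euclidean G]) (auto simp: trivialization_def intro!: continuous_intros)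
    ultimately have "trivialization C (\<lambda>e. cnj (G e))"
      using C by (simp add: trivialization_def o_def)
    then show ?thesis
      using trivialization_glue_aux[OF A _ C(2) logs ab(2,1), of "\<lambda>e. cnj (G e)"] 2 eq
      by (auto simp: add.commute)
  qed
qed

end

section \<open>Plane bundles over spheres\<close>

lemma open_contains_coordinate_box:
  fixes V :: "(nat \<Rightarrow> real) set"
  assumes "open V" "y \<in> V"
  obtains \<epsilon> where "0 < \<epsilon>" "\<And>x. \<lbrakk>\<forall>i<n. \<bar>x i - y i\<bar> \<le> \<epsilon>; \<forall>i\<ge>n. x i = y i\<rbrakk> \<Longrightarrow> x \<in> V"
proof -
  have "openin (product_topology (\<lambda>i::nat. euclideanreal) UNIV) V"
    using assms by (simp add: euclidean_product_topology)
  then obtain X where X: "y \<in> (\<Pi>\<^sub>E i\<in>UNIV. X i)" "\<And>i. open (X i)" "(\<Pi>\<^sub>E i\<in>UNIV. X i) \<subseteq> V"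
    using product_topology_open_contains_basis[of "\<lambda>i. euclideanreal" UNIV V y] assms by auto
  have "\<exists>e>0. cball (y i) e \<subseteq> X i" for i
    using X(1,2) open_contains_cball by (metis PiE_mem UNIV_I)
  then obtain e where e: "\<And>i. 0 < e i" "\<And>i. cball (y i) (e i) \<subseteq> X i" by metis
  \<comment> \<open>The 1 keeps the set nonempty when n = 0.\<close>
  define \<epsilon> where "\<epsilon> = Min (insert 1 (e ` {..<n}))"
  show ?thesis
  proof
    show "0 < \<epsilon>" using e by (simp add: \<epsilon>_def)
    fix x assume x: "\<forall>i<n. \<bar>x i - y i\<bar> \<le> \<epsilon>" "\<forall>i\<ge>n. x i = y i"
    have "x i \<in> X i" for i
    proof (cases "i < n")
      case True
      then have "\<epsilon> \<le> e i" by (simp add: \<epsilon>_def)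
      then have "x i \<in> cball (y i) (e i)" using x True by (force simp: dist_real_def)
      then show ?thesis using e by blast
    next
      case False
      then show ?thesis using x X(1) by (metis PiE_mem UNIV_I not_le)
    qed
    then show "x \<in> V" using X(3) by (auto simp: PiE_def)
  qed
qed

lemma cell_mono:
  assumes "\<And>i. i < n \<Longrightarrow> L i \<le> L' i" "\<And>i. i < n \<Longrightarrow> H' i \<le> H i"
  shows "cell s n L' H' \<subseteq> cell s n L H"
  using assms unfolding cell_def by fastforce

text \<open>As the box around y shrinks, the cell either disappears, when y projects outside the
  unit disc, or contracts to the point of the hemisphere above y.\<close>

lemma small_cell_subset:
  assumes s: "s\<^sup>2 = 1"
  obtains \<epsilon> where "0 < \<epsilon>" "cell s n (\<lambda>i. y i - \<epsilon>) (\<lambda>i. y i + \<epsilon>) = {}"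
  | b where "b \<in> Sph n" "\<And>U. openin (top_of_set (Sph n)) U \<Longrightarrow> b \<in> U \<Longrightarrow>
       \<exists>\<epsilon>>0. cell s n (\<lambda>i. y i - \<epsilon>) (\<lambda>i. y i + \<epsilon>) \<subseteq> U"
proof (cases "1 < (\<Sum>i<n. (y i)\<^sup>2)")
  case True
  let ?V = "{x :: nat \<Rightarrow> real. 1 < (\<Sum>i<n. (x i)\<^sup>2)}"
  have "open ?V"
    by (intro open_Collect_less continuous_intros continuous_on_product_coordinates)
  then obtain \<epsilon> where \<epsilon>: "0 < \<epsilon>" "\<And>x. \<lbrakk>\<forall>i<n. \<bar>x i - y i\<bar> \<le> \<epsilon>; \<forall>i\<ge>n. x i = y i\<rbrakk> \<Longrightarrow> x \<in> ?V"
    using open_contains_coordinate_box[of ?V y n] True by blast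
  have "x \<notin> cell s n (\<lambda>i. y i - \<epsilon>) (\<lambda>i. y i + \<epsilon>)" for x
  proof
    assume x: "x \<in> cell s n (\<lambda>i. y i - \<epsilon>) (\<lambda>i. y i + \<epsilon>)"
    \<comment> \<open>The box around y leaves the coordinates from n on fixed, so those of x are
      replaced by those of y; the sum does not see them.\<close>
    then have "(\<lambda>i. if i < n then x i else y i) \<in> ?V"
      by (intro \<epsilon>) (auto simp: cell_def abs_le_iff algebra_simps)
    then have "1 < (\<Sum>i<n. (x i)\<^sup>2)" by simp
    moreover have "(\<Sum>i<n. (x i)\<^sup>2) + (x n)\<^sup>2 = 1" using x by (simp add: cell_def Sph_def sum_sq_last)
    ultimately show False by (smt (verit) zero_le_power2)
  qed
  then show ?thesis using that(1) \<epsilon> by blast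
next
  case False
  \<comment> \<open>Lifts the first n coordinates to the chosen hemisphere. As \<open>sqrt\<close>
    is continuous on all reals, with negative values at negative arguments, \<open>\<tau>\<close> is
    continuous everywhere, also outside the disc.\<close>
  define \<tau> where "\<tau> x i = (if i < n then x i else if i = n then s * sqrt (1 - (\<Sum>i<n. (x i)\<^sup>2)) else 0)"
    for x :: "nat \<Rightarrow> real" and i
  have "continuous_on UNIV (\<lambda>x. \<tau> x i)" for i
    by (cases "i < n"; cases "i = n")
       (auto simp: \<tau>_def intro!: continuous_intros continuous_on_product_coordinates)
  then have cont: "continuous_on UNIV \<tau>" by (rule continuous_on_coordinatewise_then_product)
  have \<tau>_id: "\<tau> x = x" if "x \<in> cell s n L H" for x L H
  proof
    fix i
    have x: "(x n)\<^sup>2 = 1 - (\<Sum>i<n. (x i)\<^sup>2)" "0 \<le> s * x n" "\<forall>i>n. x i = 0"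
      using that by (auto simp: cell_def Sph_def sum_sq_last)
    have "s * \<bar>x n\<bar> = x n"
    proof (cases "s = 1")
      case False
      then have "s = -1" using s by (simp add: power2_eq_1_iff)
      then show ?thesis using x(2) by simp
    qed (use x(2) in simp)
    then show "\<tau> x i = x i"
      using x by (auto simp: \<tau>_def) (metis real_sqrt_abs)
  qed
  show ?thesis
  proof (rule that(2))
    show "\<tau> y \<in> Sph n"
      using False s by (auto simp: Sph_def sum_sq_last \<tau>_def power_mult_distrib)
    fix U assume U: "openin (top_of_set (Sph n)) U" "\<tau> y \<in> U"
    then obtain W where W: "open W" "U = Sph n \<inter> W" by (auto simp: openin_open)
    have "open (\<tau> -` W)" using cont W by (simp add: continuous_on_open_vimage)
    then obtain \<epsilon> where \<epsilon>: "0 < \<epsilon>" "\<And>x. \<lbrakk>\<forall>i<n. \<bar>x i - y i\<bar> \<le> \<epsilon>; \<forall>i\<ge>n. x i = y i\<rbrakk> \<Longrightarrow> x \<in> \<tau> -` W"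
      using open_contains_coordinate_box[of "\<tau> -` W" y n] U W by blast
    have "x \<in> U" if x: "x \<in> cell s n (\<lambda>i. y i - \<epsilon>) (\<lambda>i. y i + \<epsilon>)" for x
    proof -
      have "(\<lambda>i. if i < n then x i else y i) \<in> \<tau> -` W"
        using x by (intro \<epsilon>) (auto simp: cell_def abs_le_iff algebra_simps)
      moreover have "\<tau> (\<lambda>i. if i < n then x i else y i) = \<tau> x" by (auto simp: \<tau>_def)
      ultimately show ?thesis using \<tau>_id[OF x] x W by (simp add: cell_def)
    qed
    then show "\<exists>\<epsilon>>0. cell s n (\<lambda>i. y i - \<epsilon>) (\<lambda>i. y i + \<epsilon>) \<subseteq> U" using \<epsilon>(1) by blast
  qed
qed

locale sphere_plane_bundle = plane_bundle E "Sph n" p add scale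
  for E :: "'a topology" and n :: nat and p :: "'a \<Rightarrow> nat \<Rightarrow> real" and add scale
begin

lemma trivialization_empty: "trivialization {} F"
  by (simp add: trivialization_def)

lemma closedin_cell: "closedin (top_of_set (Sph n)) (cell s n L H)"
  by (intro closed_subset closed_cell) (auto simp: cell_def)

lemma trivialization_small_cell:
  assumes s: "s\<^sup>2 = 1"
  shows "\<exists>\<epsilon>>0. \<exists>F. trivialization (cell s n (\<lambda>i. y i - \<epsilon>) (\<lambda>i. y i + \<epsilon>)) F"
  using s
proof (cases rule: small_cell_subset[of s n y])
  case (1 \<epsilon>)
  then show ?thesis using trivialization_empty by auto
next
  case (2 b)
  obtain U H where "openin (top_of_set (Sph n)) U" "b \<in> U" "trivialization U H"
    using chartE[OF 2(1)] by metis
  then show ?thesis using 2(2)[of U] trivialization_subset by blast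
qed

text \<open>Induction on the number of coordinates that are not restricted to a small interval; each
  coordinate is released by subdividing its range, since the faces along which the pieces are glued
  are again cells.\<close>

lemma trivialization_slab:
  assumes s: "s\<^sup>2 = 1"
  shows "k \<le> n \<Longrightarrow> \<exists>\<epsilon>>0. \<exists>F. trivialization
    (cell s n (\<lambda>i. if i < k then -1 else y i - \<epsilon>) (\<lambda>i. if i < k then 1 else y i + \<epsilon>)) F"
proof (induction k arbitrary: y)
  case 0
  then show ?case using trivialization_small_cell[OF s] by simp
next
  case (Suc k)
  define Q where "Q u v \<epsilon> = cell s n (\<lambda>i. if i < k then -1 else if i = k then u else y i - \<epsilon>)
      (\<lambda>i. if i < k then 1 else if i = k then v else y i + \<epsilon>)" for u v \<epsilon>
  define P where "P u v \<longleftrightarrow> (\<exists>\<epsilon>>0. \<exists>F. trivialization (Q u v \<epsilon>) F)" for u v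
  have mono: "Q u v \<epsilon> \<subseteq> Q u v \<delta>" if "\<epsilon> \<le> \<delta>" for u v \<epsilon> \<delta>
    unfolding Q_def by (rule cell_mono) (use that in auto)
  \<comment> \<open>Bisection: a property of intervals that passes to unions of adjacent ones and
    holds for short intervals around each point holds for the whole range. The thickness in the
    later coordinates is quantified inside \<open>P\<close>, since two adjacent pieces may have
    different ones and only their minimum serves both.\<close>
  have "P (-1) 1"
  proof (rule Bolzano)
    fix a b c assume ab: "P a b" "P b c" "a \<le> b" "b \<le> c"
    obtain \<epsilon> F where \<epsilon>: "0 < \<epsilon>" "trivialization (Q a b \<epsilon>) F" using ab by (auto simp: P_def)
    obtain \<delta> G where \<delta>: "0 < \<delta>" "trivialization (Q b c \<delta>) G" using ab by (auto simp: P_def)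
    let ?m = "min \<epsilon> \<delta>"
    have F: "trivialization (Q a b ?m) F" by (rule trivialization_subset[OF \<epsilon>(2) mono]) simp
    have G: "trivialization (Q b c ?m) G" by (rule trivialization_subset[OF \<delta>(2) mono]) simp
    have I: "Q a b ?m \<inter> Q b c ?m = Q b b ?m"
      using Suc.prems ab(3,4) unfolding Q_def cell_def by (auto split: if_splits; smt (verit))
    have U: "Q a b ?m \<union> Q b c ?m = Q a c ?m"
      using Suc.prems ab(3,4) unfolding Q_def cell_def by (auto split: if_splits; smt (verit))
    have "\<exists>F'. trivialization (Q a b ?m \<union> Q b c ?m) F'"
    proof (rule trivialization_glue[OF F _ G])
      show "connected (Q a b ?m \<inter> Q b c ?m)" "has_logs (Q a b ?m \<inter> Q b c ?m)"
        unfolding I by (simp_all add: Q_def cell_connected cell_has_logs s)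
    qed (simp_all add: Q_def closedin_cell)
    then show "P a c" unfolding P_def U using \<epsilon>(1) \<delta>(1) by (intro exI[of _ ?m]) simp
  next
    fix x :: real
    \<comment> \<open>With coordinate k of the centre moved to x, the thickness \<epsilon> also
      covers coordinate k and so every interval around x shorter than \<epsilon>.\<close>
    obtain \<epsilon> F where \<epsilon>: "0 < \<epsilon>" "trivialization (cell s n (\<lambda>i. if i < k then -1 else (y(k := x)) i - \<epsilon>)
        (\<lambda>i. if i < k then 1 else (y(k := x)) i + \<epsilon>)) F"
      using Suc.IH[of "y(k := x)"] Suc.prems by auto
    have "P a b" if "a \<le> x" "x \<le> b" "b - a < \<epsilon>" for a b
      unfolding P_def Q_def
      by (intro exI[of _ \<epsilon>] conjI \<epsilon>(1) exI[of _ F] trivialization_subset[OF \<epsilon>(2)] cell_mono)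
         (use that in auto)
    then show "\<exists>d>0. \<forall>a b. a \<le> x \<and> x \<le> b \<and> b - a < d \<longrightarrow> P a b" using \<epsilon>(1) by blast
  qed simp
  moreover have "(if i < k then c else if i = k then c else z) = (if i < Suc k then c else z)" for i and c z :: real
    by (auto simp: less_Suc_eq)
  ultimately show ?case unfolding P_def Q_def by simp
qed

lemma trivialization_hemisphere:
  assumes "s\<^sup>2 = 1" shows "\<exists>F. trivialization (cell s n (\<lambda>_. -1) (\<lambda>_. 1)) F"
proof -
  obtain \<epsilon> F where "trivialization
    (cell s n (\<lambda>i. if i < n then -1 else 0 - \<epsilon>) (\<lambda>i. if i < n then 1 else 0 + \<epsilon>)) F"
    using trivialization_slab[OF assms order_refl, of "\<lambda>_. 0"] by blast
  moreover have "cell s n (\<lambda>_. -1) (\<lambda>_. 1) \<subseteq> cell s n (\<lambda>i. if i < n then -1 else 0 - \<epsilon>) (\<lambda>i. if i < n then 1 else 0 + \<epsilon>)"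
    by (rule cell_mono) auto
  ultimately show ?thesis using trivialization_subset by blast
qed

text \<open>The bound on n enters here: the hemispheres overlap in a sphere of dimension n - 1 \<ge>
  2, which is connected and has logarithms, so the clutching function cannot wind.\<close>

lemma trivialization_sphere:
  assumes "2 < n" shows "\<exists>F. trivialization (Sph n) F"
proof -
  obtain m where m: "n = Suc (Suc m)" "m \<noteq> 0" using assms by (metis less_2_cases_iff less_antisym not0_implies_Suc not_less_zero numeral_2_eq_2)
  obtain F G where FG: "trivialization (cell 1 n (\<lambda>_. -1) (\<lambda>_. 1)) F" "trivialization (cell (-1) n (\<lambda>_. -1) (\<lambda>_. 1)) G"
    using trivialization_hemisphere[of 1] trivialization_hemisphere[of "-1"] by auto
  have eq: "cell 1 n (\<lambda>_. -1) (\<lambda>_. 1) \<inter> cell (-1) n (\<lambda>_. -1) (\<lambda>_. 1) = Sph (Suc m)"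
    unfolding cells_Int_equator m Sph_equator ..
  have "connected (Sph (Suc m))" "has_logs (Sph (Suc m))"
    using m by (simp_all add: connected_Sph has_logs_Sph)
  then show ?thesis
    using trivialization_glue[OF FG(1) closedin_cell FG(2) closedin_cell]
    by (simp only: eq Sph_eq_Un_cells[symmetric])
qed

end

text \<open>The inverse is chosen fibre by fibre. Over a chart it equals the inverse of the chart
  composed with the continuous transition map from F to the coordinate of the chart, so it is
  continuous.\<close>

lemma (in plane_bundle) trivialization_inverse:
  assumes F: "trivialization B F"
  obtains \<Psi> where "continuous_map (prod_topology (top_of_set B) euclidean) E \<Psi>"
    "\<And>b z. b \<in> B \<Longrightarrow> \<Psi> (b, z) \<in> topspace E \<and> p (\<Psi> (b, z)) = b \<and> F (\<Psi> (b, z)) = z"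
    "\<And>e. e \<in> topspace E \<Longrightarrow> \<Psi> (p e, F e) = e"
proof -
  have lin: "is_lin b F" if "b \<in> B" for b using F that by (simp add: trivialization_def)
  obtain \<Psi> where \<Psi>: "\<And>b z. b \<in> B \<Longrightarrow> \<Psi> (b, z) \<in> fibre b \<and> F (\<Psi> (b, z)) = z"
  proof -
    have "\<exists>x. b \<in> B \<longrightarrow> x \<in> fibre b \<and> F x = z" for b z using is_lin_surj[OF lin] by blast
    then obtain \<psi> where "\<And>b z. b \<in> B \<Longrightarrow> \<psi> b z \<in> fibre b \<and> F (\<psi> b z) = z" by metis
    then show ?thesis using that[of "\<lambda>(b, z). \<psi> b z"] by simp
  qed
  have left: "\<Psi> (p e, F e) = e" if "e \<in> topspace E" for e
  proof -
    have b: "p e \<in> B" using cont_p that by (auto simp: continuous_map_def)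
    show ?thesis
      by (rule is_lin_inj[OF lin[OF b]]) (use \<Psi>[OF b] that in \<open>auto simp: fibre_def\<close>)
  qed
  have "continuous_map (prod_topology (top_of_set B) euclidean) E \<Psi>"
  proof (rule continuous_map_locallyI)
    fix x :: "'b \<times> complex" assume "x \<in> topspace (prod_topology (top_of_set B) euclidean)"
    then have "fst x \<in> B" by auto
    then obtain U H \<psi> where U: "openin (top_of_set B) U" "fst x \<in> U" and H: "trivialization U H"
      and \<psi>: "continuous_map (prod_topology (top_of_set U) euclidean) E \<psi>"
      and fib: "\<And>u z. u \<in> U \<Longrightarrow> \<psi> (u, z) \<in> fibre u \<and> H (\<psi> (u, z)) = z"
      and inv: "\<And>e. e \<in> topspace E \<Longrightarrow> p e \<in> U \<Longrightarrow> \<psi> (p e, H e) = e"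
      by (rule chartE) blast
    have UB: "U \<subseteq> B" using H by (simp add: trivialization_def)
    obtain \<alpha> \<beta> where ab: "continuous_on U \<alpha>" "continuous_on U \<beta>"
      "\<forall>b\<in>U. \<forall>x\<in>fibre b. H x = \<alpha> b * F x + \<beta> b * cnj (F x)"
      using transition_continuous[OF H trivialization_subset[OF F UB]] by blast
    have eq: "\<Psi> (b, z) = \<psi> (b, \<alpha> b * z + \<beta> b * cnj z)" if b: "b \<in> U" for b z
    proof -
      have f: "\<Psi> (b, z) \<in> fibre b" "F (\<Psi> (b, z)) = z" using \<Psi> UB b by auto
      have "\<psi> (b, H (\<Psi> (b, z))) = \<Psi> (b, z)" using inv[of "\<Psi> (b, z)"] f b by (auto simp: fibre_def)
      moreover have "H (\<Psi> (b, z)) = \<alpha> b * z + \<beta> b * cnj z" using ab(3) b f by force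
      ultimately show ?thesis by simp
    qed
    have top: "prod_topology (top_of_set U) euclidean = top_of_set (U \<times> (UNIV :: complex set))"
      using prod_topology_subtopology_eu[of U "UNIV :: complex set"] by simp
    have sub: "subtopology (prod_topology (top_of_set B) euclidean) (U \<times> UNIV) = top_of_set (U \<times> (UNIV :: complex set))"
      using prod_topology_subtopology_eu[of B "UNIV :: complex set"] UB
      by (simp add: subtopology_subtopology Times_Int_Times inf.absorb2)
    have "continuous_on (U \<times> UNIV) (\<lambda>(b, z). (b, \<alpha> b * z + \<beta> b * cnj z))"
      unfolding case_prod_unfold
      by (intro continuous_intros continuous_on_compose2[OF ab(1)] continuous_on_compose2[OF ab(2)]) auto
    then have "continuous_map (top_of_set (U \<times> UNIV)) (top_of_set (U \<times> UNIV)) (\<lambda>(b, z). (b, \<alpha> b * z + \<beta> b * cnj z))"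
      by auto
    then have "continuous_map (top_of_set (U \<times> UNIV)) E (\<psi> \<circ> (\<lambda>(b, z). (b, \<alpha> b * z + \<beta> b * cnj z)))"
      using \<psi> unfolding top by (rule continuous_map_compose)
    then have "continuous_map (top_of_set (U \<times> UNIV)) E \<Psi>"
      by (rule continuous_map_eq) (auto simp: eq)
    then show "\<exists>T. openin (prod_topology (top_of_set B) euclidean) T \<and> x \<in> T \<and>
        continuous_map (subtopology (prod_topology (top_of_set B) euclidean) T) E \<Psi>"
      using U by (intro exI[of _ "U \<times> UNIV"]) (auto simp: sub openin_prod_Times_iff mem_Times_iff)
  qed
  then show ?thesis using that \<Psi> left by (auto simp: fibre_def)
qed

text \<open>A change of language: the linear homeomorphism \<open>vc\<close> identifies the fibre
  \<open>real^2\<close> with the complex plane.\<close>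

lemma real_vector_bundle_imp_sphere_plane_bundle:
  assumes "real_vector_bundle E (nsphere n) p TYPE(real^2)"
  obtains add scale where "sphere_plane_bundle E n p add scale"
proof -
  have p: "continuous_map E (top_of_set (Sph n)) p"
    using assms by (simp add: real_vector_bundle_def nsphere_eq_top_of_set)
  obtain add scale where as: "\<forall>b \<in> Sph n. \<exists>U (\<phi> :: 'a \<Rightarrow> (nat \<Rightarrow> real) \<times> (real^2)).
          openin (top_of_set (Sph n)) U \<and> b \<in> U \<and>
          homeomorphic_map (subtopology E {e \<in> topspace E. p e \<in> U})
                           (prod_topology (subtopology (top_of_set (Sph n)) U) euclidean) \<phi> \<and>
          (\<forall>e \<in> topspace E. p e \<in> U \<longrightarrow> fst (\<phi> e) = p e) \<and>
          (\<forall>x \<in> topspace E. \<forall>y \<in> topspace E. p x \<in> U \<and> p y = p x \<longrightarrow>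
              add x y \<in> topspace E \<and> p (add x y) = p x \<and>
              snd (\<phi> (add x y)) = snd (\<phi> x) + snd (\<phi> y)) \<and>
          (\<forall>x \<in> topspace E. \<forall>c. p x \<in> U \<longrightarrow>
              scale c x \<in> topspace E \<and> p (scale c x) = p x \<and>
              snd (\<phi> (scale c x)) = c *\<^sub>R snd (\<phi> x))"
    using assms unfolding real_vector_bundle_def nsphere_eq_top_of_set by auto
  have pin: "p x \<in> Sph n" if "x \<in> topspace E" for x
    using p that by (auto simp: continuous_map_def)
  define vc :: "real^2 \<Rightarrow> complex" where "vc v = Complex (v $ 1) (v $ 2)" for v
  define cv :: "complex \<Rightarrow> real^2" where "cv z = vector [Re z, Im z]" for z
  have vc_cv [simp]: "vc (cv z) = z" and cv_vc [simp]: "cv (vc v) = v" for z v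
    by (auto simp: vc_def cv_def vec_eq_iff forall_2)
  have vc_lin: "vc (v + w) = vc v + vc w" "vc (c *\<^sub>R v) = c *\<^sub>R vc v" for v w c
    by (auto simp: vc_def complex_eq_iff)
  have cont_vc: "continuous_on UNIV vc"
    unfolding vc_def Complex_eq by (intro continuous_intros)
  have cont_cv: "continuous_on UNIV cv"
  proof -
    have "cv = (\<lambda>z. Re z *\<^sub>R axis 1 1 + Im z *\<^sub>R axis 2 1)"
      by (auto simp: cv_def vec_eq_iff forall_2 axis_def)
    then show ?thesis by (auto intro!: continuous_intros)
  qed
  have "sphere_plane_bundle E n p add scale"
    unfolding sphere_plane_bundle_def
  proof
    show "continuous_map E (top_of_set (Sph n)) p" by (rule p)
    show "add x y \<in> topspace E \<and> p (add x y) = p x" if "x \<in> topspace E" "y \<in> topspace E" "p y = p x" for x y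
      using as pin[OF that(1)] that by meson
    show "scale c x \<in> topspace E \<and> p (scale c x) = p x" if "x \<in> topspace E" for c x
      using as pin[OF that] that by meson
    fix b assume b: "b \<in> Sph n"
    obtain U and \<phi> :: "'a \<Rightarrow> (nat \<Rightarrow> real) \<times> (real^2)" where U: "openin (top_of_set (Sph n)) U" "b \<in> U"
      and hom: "homeomorphic_map (subtopology E {e \<in> topspace E. p e \<in> U})
                           (prod_topology (subtopology (top_of_set (Sph n)) U) euclidean) \<phi>"
      and fst: "\<forall>e \<in> topspace E. p e \<in> U \<longrightarrow> fst (\<phi> e) = p e"
      and add: "\<forall>x \<in> topspace E. \<forall>y \<in> topspace E. p x \<in> U \<and> p y = p x \<longrightarrow>
              add x y \<in> topspace E \<and> p (add x y) = p x \<and>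
              snd (\<phi> (add x y)) = snd (\<phi> x) + snd (\<phi> y)"
      and scale: "\<forall>x \<in> topspace E. \<forall>c. p x \<in> U \<longrightarrow>
              scale c x \<in> topspace E \<and> p (scale c x) = p x \<and>
              snd (\<phi> (scale c x)) = c *\<^sub>R snd (\<phi> x)"
      using bspec[OF as b] by (elim exE conjE) (rule that, assumption+)
    let ?X = "subtopology E {e \<in> topspace E. p e \<in> U}"
    have sub: "subtopology (top_of_set (Sph n)) U = top_of_set U"
      using U openin_imp_subset by (metis subtopology_subtopology inf.absorb_iff2)
    obtain \<psi> where \<psi>: "homeomorphic_maps ?X (prod_topology (top_of_set U) euclidean) \<phi> \<psi>"
      using hom unfolding sub homeomorphic_map_maps by blast
    define H where "H e = vc (snd (\<phi> e))" for e
    define \<Psi> where "\<Psi> x = \<psi> (fst x, cv (snd x))" for x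
    have \<phi>_cont: "continuous_map ?X (prod_topology (top_of_set U) euclidean) \<phi>"
      and \<psi>_cont: "continuous_map (prod_topology (top_of_set U) euclidean) ?X \<psi>"
      and \<psi>_\<phi>: "\<And>e. e \<in> topspace E \<Longrightarrow> p e \<in> U \<Longrightarrow> \<psi> (\<phi> e) = e"
      and \<phi>_\<psi>: "\<And>u v. u \<in> U \<Longrightarrow> \<phi> (\<psi> (u, v)) = (u, v)"
      using \<psi> by (auto simp: homeomorphic_maps_def)
    have \<psi>_in: "\<psi> (u, v) \<in> topspace E" "p (\<psi> (u, v)) \<in> U" if "u \<in> U" for u v
      using \<psi>_cont that by (auto simp: continuous_map_def Pi_iff)
    have "continuous_map ?X euclidean (snd \<circ> \<phi>)"
      using \<phi>_cont continuous_map_snd continuous_map_compose by blast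
    then have "continuous_map ?X euclidean (vc \<circ> (snd \<circ> \<phi>))"
      using cont_vc by (intro continuous_map_compose[of _ euclidean "snd \<circ> \<phi>"]) auto
    then have H: "continuous_map ?X euclidean H" by (simp add: H_def[abs_def] o_def)
    have "continuous_map (prod_topology (top_of_set U) euclidean) euclidean (cv \<circ> snd)"
      using cont_cv continuous_map_snd by (intro continuous_map_compose[of _ euclidean]) auto
    then have "continuous_map (prod_topology (top_of_set U) euclidean) (prod_topology (top_of_set U) euclidean)
        (\<lambda>x. (fst x, cv (snd x)))"
      by (intro continuous_map_pairedI continuous_map_fst) (simp add: o_def)
    then have "continuous_map (prod_topology (top_of_set U) euclidean) ?X (\<psi> \<circ> (\<lambda>x. (fst x, cv (snd x))))"
      using \<psi>_cont continuous_map_compose by blast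
    then have \<Psi>: "continuous_map (prod_topology (top_of_set U) euclidean) E \<Psi>"
      by (simp add: \<Psi>_def[abs_def] o_def continuous_map_in_subtopology)
    have 1: "\<forall>u\<in>U. \<forall>z. p (\<Psi> (u, z)) = u \<and> H (\<Psi> (u, z)) = z"
    proof (intro ballI allI)
      fix u z assume u: "u \<in> U"
      have "\<phi> (\<Psi> (u, z)) = (u, cv z)" using \<phi>_\<psi>[OF u] by (simp add: \<Psi>_def)
      moreover have "p (\<Psi> (u, z)) = fst (\<phi> (\<Psi> (u, z)))"
        using fst \<psi>_in[OF u] by (simp add: \<Psi>_def)
      ultimately show "p (\<Psi> (u, z)) = u \<and> H (\<Psi> (u, z)) = z" by (simp add: H_def)
    qed
    have 2: "\<forall>e\<in>topspace E. p e \<in> U \<longrightarrow> \<Psi> (p e, H e) = e"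
    proof (intro ballI impI)
      fix e assume e: "e \<in> topspace E" "p e \<in> U"
      then have "(p e, snd (\<phi> e)) = \<phi> e" using fst by (simp add: prod_eq_iff)
      then show "\<Psi> (p e, H e) = e" using \<psi>_\<phi>[OF e] by (simp add: \<Psi>_def H_def)
    qed
    show "\<exists>U H \<Psi>. openin (top_of_set (Sph n)) U \<and> b \<in> U \<and>
      continuous_map (subtopology E {e \<in> topspace E. p e \<in> U}) euclidean (H :: 'a \<Rightarrow> complex) \<and>
      continuous_map (prod_topology (top_of_set U) euclidean) E \<Psi> \<and>
      (\<forall>u\<in>U. \<forall>z. p (\<Psi> (u, z)) = u \<and> H (\<Psi> (u, z)) = z) \<and>
      (\<forall>e\<in>topspace E. p e \<in> U \<longrightarrow> \<Psi> (p e, H e) = e) \<and>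
      (\<forall>x\<in>topspace E. \<forall>y\<in>topspace E. p x \<in> U \<and> p y = p x \<longrightarrow> H (add x y) = H x + H y) \<and>
      (\<forall>x\<in>topspace E. \<forall>c. p x \<in> U \<longrightarrow> H (scale c x) = c *\<^sub>R H x)"
      by (intro exI conjI, rule U(1), rule U(2), rule H, rule \<Psi>, rule 1, rule 2)
         (use add scale in \<open>auto simp: H_def vc_lin\<close>)
  qed
  then show ?thesis by (rule that)
qed

text \<open>Along the circle a logarithm of the k-th power grows by 2 pi i k, yet it must return to
  its initial value. Subtracting this growth gives d, constant on the line by discreteness of the
  periods but different at 0 and 2 pi.\<close>

lemma no_log_power_circle:
  assumes "k \<noteq> 0" "c \<noteq> 0" "continuous_on (sphere (0::complex) 1) g"
  shows "\<exists>z\<in>sphere 0 1. (c * z) ^ k \<noteq> exp (g z)"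
proof (rule ccontr)
  assume "\<not> ?thesis"
  then have g: "(c * z) ^ k = exp (g z)" if "cmod z = 1" for z using that by auto
  define d where "d t = g (cis t) - of_real (real k * t) * \<i> - g 1" for t
  have "continuous_on UNIV (\<lambda>t. g (cis t))"
    by (rule continuous_on_compose2[OF assms(3)]) (auto intro!: continuous_intros simp: cis_conv_exp)
  then have "continuous_on UNIV d"
    unfolding d_def by (intro continuous_intros)
  moreover have "exp (d t) = 1" for t
  proof -
    have "exp (g (cis t)) = c ^ k * cis (real k * t)"
      using g[of "cis t"] by (simp add: power_mult_distrib flip: Complex.DeMoivre)
    moreover have "exp (g 1) = c ^ k" using g[of 1] by simp
    ultimately show ?thesis
      using assms by (simp add: d_def exp_diff cis_conv_exp mult.commute)
  qed
  ultimately obtain a where a: "\<forall>t\<in>UNIV. d t = a"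
    using continuous_exp_eq_1_constant[of UNIV d] by auto
  have "d 0 = d (2 * pi)" using a by simp
  then show False using assms by (simp add: d_def)
qed

section \<open>Orbit spaces of finite free actions\<close>

text \<open>Elements of G are functions on the whole type and may agree on the space while differing
  outside it. Restricting them removes such duplicates, so that each point of an orbit is reached by
  exactly one element and sums over the group become sums over orbits.\<close>

lemma finite_free_group_action_normalize:
  assumes act: "finite_free_group_action S G" and ne: "topspace S \<noteq> {}"
    and orb: "\<forall>x \<in> topspace S. \<forall>y \<in> topspace S. q x = q y \<longleftrightarrow> (\<exists>g \<in> G. y = g x)"
  obtains \<Gamma> e where "finite \<Gamma>" "e \<in> \<Gamma>" "\<And>x. x \<in> topspace S \<Longrightarrow> e x = x" "\<And>g. g \<in> \<Gamma> \<Longrightarrow> continuous_map S S g"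
    "\<And>x y. \<lbrakk>x \<in> topspace S; y \<in> topspace S\<rbrakk> \<Longrightarrow> q x = q y \<longleftrightarrow> (\<exists>g \<in> \<Gamma>. y = g x)"
    "\<And>g h x. \<lbrakk>g \<in> \<Gamma>; h \<in> \<Gamma>; x \<in> topspace S; g x = h x\<rbrakk> \<Longrightarrow> g = h"
proof -
  let ?T = "topspace S"
  note act' = act[unfolded finite_free_group_action_def]
  have finG: "finite G" using act' by (elim conjE)
  have homs: "\<forall>g\<in>G. homeomorphic_map S S g" using act' by (elim conjE)
  have unit: "\<exists>e\<in>G. \<forall>x\<in>?T. e x = x" using act' by (elim conjE)
  have mult: "\<forall>g\<in>G. \<forall>h\<in>G. \<exists>k\<in>G. \<forall>x\<in>?T. k x = g (h x)" using act' by (elim conjE)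
  have inv: "\<forall>g\<in>G. \<exists>h\<in>G. \<forall>x\<in>?T. h (g x) = x" using act' by (elim conjE)
  have free: "\<forall>g\<in>G. (\<exists>x\<in>?T. g x = x) \<longrightarrow> (\<forall>x\<in>?T. g x = x)" using act' by (elim conjE)
  obtain e where e: "e \<in> G" "\<forall>x\<in>?T. e x = x" using unit by blast
  let ?\<Gamma> = "(\<lambda>g. restrict g ?T) ` G"
  show ?thesis
  proof (rule that[of ?\<Gamma> "restrict e ?T"])
    have hom: "homeomorphic_map S S g" if "g \<in> G" for g
      using homs that by blast
    have into: "g x \<in> ?T" if "g \<in> G" "x \<in> ?T" for g x
      using hom[OF that(1)] that(2) by (meson continuous_map_image_subset_topspace homeomorphic_imp_continuous_map image_subset_iff)
    show "finite ?\<Gamma>" using finG by simp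
    show "restrict e ?T \<in> ?\<Gamma>" using e by blast
    show "restrict e ?T x = x" if "x \<in> ?T" for x using e that by simp
    show "continuous_map S S g" if "g \<in> ?\<Gamma>" for g
    proof -
      obtain g' where g': "g' \<in> G" "g = restrict g' ?T" using \<open>g \<in> ?\<Gamma>\<close> by blast
      show ?thesis
        using homeomorphic_imp_continuous_map[OF hom[OF g'(1)]] by (rule continuous_map_eq) (simp add: g')
    qed
    show "q x = q y \<longleftrightarrow> (\<exists>g \<in> ?\<Gamma>. y = g x)" if "x \<in> ?T" "y \<in> ?T" for x y
      using orb that by auto
    show "g = h" if gh: "g \<in> ?\<Gamma>" "h \<in> ?\<Gamma>" and x: "x \<in> ?T" and eq: "g x = h x" for g h x
    proof -
      obtain g' h' where g': "g' \<in> G" "g = restrict g' ?T" and h': "h' \<in> G" "h = restrict h' ?T" using gh by blast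
      obtain k where k: "k \<in> G" "\<forall>y\<in>?T. k (g' y) = y"
        using inv g'(1) by blast
      \<comment> \<open>l represents the inverse of g' followed after h'. It fixes x, so by freeness
        it is the identity and g', h' agree on the space.\<close>
      obtain l where l: "l \<in> G" "\<forall>y\<in>?T. l y = k (h' y)"
        using mult k(1) h'(1) by blast
      have "k (h' x) = x" using bspec[OF k(2) x] x eq g'(2) h'(2) by simp
      then have "l x = x" using l(2) x by simp
      then have "\<forall>y\<in>?T. l y = y" using free l(1) x by blast
      moreover have injk: "inj_on k ?T" using hom[OF k(1)] by (simp add: homeomorphic_imp_injective_map)
      ultimately have "g' y = h' y" if "y \<in> ?T" for y
        using inj_onD[OF injk, of "g' y" "h' y"] that k(2) l(2) into[OF g'(1)] into[OF h'(1)] by simp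
      then show ?thesis using g' h' by auto
    qed
  qed
qed

text \<open>The sum of a logarithm over the points of an orbit is a logarithm of a power that descends to the
  orbit space.\<close>

lemma orbit_space_power_log:
  assumes act: "finite_free_group_action (top_of_set S) G" and N: "is_orbit_space (top_of_set S) G N"
    and logs: "has_logs S" and ne: "S \<noteq> {}"
  obtains k :: nat where "k \<noteq> 0"
    "\<And>f :: 'n \<Rightarrow> complex. \<lbrakk>continuous_map N euclidean f; \<And>x. x \<in> topspace N \<Longrightarrow> f x \<noteq> 0\<rbrakk> \<Longrightarrow>
       \<exists>g. continuous_map N euclidean g \<and> (\<forall>x\<in>topspace N. f x ^ k = exp (g x))"
proof -
  obtain q where q: "quotient_map (top_of_set S) N q"
    and orb: "\<forall>x \<in> topspace (top_of_set S). \<forall>y \<in> topspace (top_of_set S). q x = q y \<longleftrightarrow> (\<exists>g \<in> G. y = g x)"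
    using N unfolding is_orbit_space_def by blast
  obtain \<Gamma> e where fin: "finite \<Gamma>" and e: "e \<in> \<Gamma>"
    and cont: "\<And>g. g \<in> \<Gamma> \<Longrightarrow> continuous_map (top_of_set S) (top_of_set S) g"
    and orb: "\<And>x y. \<lbrakk>x \<in> S; y \<in> S\<rbrakk> \<Longrightarrow> q x = q y \<longleftrightarrow> (\<exists>g \<in> \<Gamma>. y = g x)"
    and free: "\<And>g h x. \<lbrakk>g \<in> \<Gamma>; h \<in> \<Gamma>; x \<in> S; g x = h x\<rbrakk> \<Longrightarrow> g = h"
    using ne by (auto intro: finite_free_group_action_normalize[OF act _ orb])
  have into: "g x \<in> S" if "g \<in> \<Gamma>" "x \<in> S" for g x
    using cont[OF that(1)] that(2) by auto
  show ?thesis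
  proof
    show "card \<Gamma> \<noteq> 0" using fin e by auto
    fix f :: "'n \<Rightarrow> complex"
    assume f: "continuous_map N euclidean f" "\<And>x. x \<in> topspace N \<Longrightarrow> f x \<noteq> 0"
    have qc: "continuous_map (top_of_set S) N q" using q by (rule quotient_imp_continuous_map)
    have qN: "q y \<in> topspace N" if "y \<in> S" for y using qc that by (auto simp: continuous_map_def)
    have "continuous_map (top_of_set S) euclidean (f \<circ> q)" using qc f(1) by (rule continuous_map_compose)
    then have "continuous_on S (f \<circ> q)" by simp
    then obtain h where h: "continuous_on S h" "\<And>y. y \<in> S \<Longrightarrow> (f \<circ> q) y = exp (h y)"
      using has_logsE[OF logs, of "f \<circ> q"] f(2) qN by auto
    define s where "s y = (\<Sum>g\<in>\<Gamma>. h (g y))" for y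
    \<comment> \<open>By freeness the group is in bijection with the fibre of q through y. Written
      over that fibre, the sum visibly depends on q y alone.\<close>
    have s_fibre: "s y = (\<Sum>w\<in>{w \<in> S. q w = q y}. h w)" if y: "y \<in> S" for y
    proof -
      have "inj_on (\<lambda>g. g y) \<Gamma>" using free y by (auto intro: inj_onI)
      moreover have "(\<lambda>g. g y) ` \<Gamma> = {w \<in> S. q w = q y}"
      proof (intro equalityI subsetI)
        fix w assume "w \<in> (\<lambda>g. g y) ` \<Gamma>"
        then obtain g where g: "g \<in> \<Gamma>" "w = g y" by blast
        then show "w \<in> {w \<in> S. q w = q y}" using into[OF g(1) y] orb[OF y, of w] by auto
      next
        fix w assume "w \<in> {w \<in> S. q w = q y}"
        then show "w \<in> (\<lambda>g. g y) ` \<Gamma>" using orb[OF y, of w] by auto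
      qed
      ultimately show ?thesis unfolding s_def using sum.reindex[of "\<lambda>g. g y" \<Gamma> h] by (simp add: o_def)
    qed
    have "continuous_on S s"
      unfolding s_def using cont by (intro continuous_on_sum continuous_on_compose2[OF h(1)]) auto
    then have "continuous_map (top_of_set S) euclidean s" by simp
    moreover have "s y = s y'" if "y \<in> S" "y' \<in> S" "q y = q y'" for y y'
      unfolding s_fibre[OF that(1)] s_fibre[OF that(2)] that(3) ..
    ultimately obtain g where g: "continuous_map N euclidean g" "\<And>y. y \<in> S \<Longrightarrow> g (q y) = s y"
      by (rule quotient_map_lift_exists[OF q]) auto
    have "f x ^ card \<Gamma> = exp (g x)" if xN: "x \<in> topspace N" for x
    proof -
      obtain y where y: "y \<in> S" "x = q y"
        using quotient_imp_surjective_map[OF q] xN by auto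
      have "exp (s y) = (\<Prod>g\<in>\<Gamma>. exp (h (g y)))" by (simp add: s_def exp_sum fin)
      also have "\<dots> = (\<Prod>g\<in>\<Gamma>. f (q y))"
      proof (rule prod.cong[OF refl])
        fix g assume "g \<in> \<Gamma>"
        then have "g y \<in> S" "q y = q (g y)" using into orb y by blast+
        then show "exp (h (g y)) = f (q y)" using h(2)[of "g y"] by simp
      qed
      finally show ?thesis using y g by simp
    qed
    then show "\<exists>g. continuous_map N euclidean g \<and> (\<forall>x\<in>topspace N. f x ^ card \<Gamma> = exp (g x))"
      using g(1) by blast
  qed
qed

text \<open>The quotient map is a local homeomorphism: each of the finitely many elements moving y
  moves a small neighbourhood of y off itself, and q is injective and open on the intersection of
  these. Its inverse carries local coordinates of S over to N.\<close>

lemma orbit_space_local_section: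
  assumes act: "finite_free_group_action S G" and N: "is_orbit_space S G N"
    and haus: "Hausdorff_space S" and y: "y \<in> topspace S" and W0: "openin S W0" "y \<in> W0"
  obtains V r where "openin N V" "V \<noteq> {}" "continuous_map (subtopology N V) (subtopology S W0) r" "inj_on r V"
proof -
  obtain q where q: "quotient_map S N q"
    and orb: "\<forall>x \<in> topspace S. \<forall>y \<in> topspace S. q x = q y \<longleftrightarrow> (\<exists>g \<in> G. y = g x)"
    using N unfolding is_orbit_space_def by blast
  obtain \<Gamma> e where fin: "finite \<Gamma>" and e: "e \<in> \<Gamma>" "\<And>x. x \<in> topspace S \<Longrightarrow> e x = x"
    and cont: "\<And>g. g \<in> \<Gamma> \<Longrightarrow> continuous_map S S g"
    and orb: "\<And>x y. \<lbrakk>x \<in> topspace S; y \<in> topspace S\<rbrakk> \<Longrightarrow> q x = q y \<longleftrightarrow> (\<exists>g \<in> \<Gamma>. y = g x)"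
    and free: "\<And>g h x. \<lbrakk>g \<in> \<Gamma>; h \<in> \<Gamma>; x \<in> topspace S; g x = h x\<rbrakk> \<Longrightarrow> g = h"
    using finite_free_group_action_normalize[OF act _ orb] y by blast
  have into: "g x \<in> topspace S" if "g \<in> \<Gamma>" "x \<in> topspace S" for g x
    using cont[OF that(1)] that(2) by (auto simp: continuous_map_def)
  \<comment> \<open>The saturation of V is a union of preimages of V under group elements, hence
    open.\<close>
  have open_q: "openin N (q ` V)" if V: "openin S V" for V
  proof -
    have VS: "V \<subseteq> topspace S" using V openin_subset by blast
    have "{x \<in> topspace S. q x \<in> q ` V} = (\<Union>g\<in>\<Gamma>. {x \<in> topspace S. g x \<in> V})"
    proof (intro equalityI subsetI)
      fix x assume "x \<in> {x \<in> topspace S. q x \<in> q ` V}"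
      then obtain v where v: "x \<in> topspace S" "v \<in> V" "q x = q v" by blast
      then show "x \<in> (\<Union>g\<in>\<Gamma>. {x \<in> topspace S. g x \<in> V})" using orb[of x v] VS by auto
    next
      fix x assume "x \<in> (\<Union>g\<in>\<Gamma>. {x \<in> topspace S. g x \<in> V})"
      then obtain g where "g \<in> \<Gamma>" "x \<in> topspace S" "g x \<in> V" by blast
      moreover from this have "q x = q (g x)" using orb into by blast
      ultimately show "x \<in> {x \<in> topspace S. q x \<in> q ` V}" by auto
    qed
    moreover have "openin S (\<Union>g\<in>\<Gamma>. {x \<in> topspace S. g x \<in> V})"
      using openin_continuous_map_preimage[OF cont V] by blast
    moreover have "q ` V \<subseteq> topspace N"
      using q VS quotient_imp_surjective_map by blast
    ultimately show ?thesis using q unfolding quotient_map_def by auto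
  qed
  have "\<exists>A. openin S A \<and> y \<in> A \<and> (\<forall>w\<in>A. g w \<notin> A)" if g: "g \<in> \<Gamma>" "g y \<noteq> y" for g
  proof -
    obtain A B where AB: "openin S A" "openin S B" "y \<in> A" "g y \<in> B" "disjnt A B"
      using haus y into[OF g(1) y] g(2) unfolding Hausdorff_space_def by metis
    let ?C = "A \<inter> {x \<in> topspace S. g x \<in> B}"
    have "openin S ?C" using AB openin_continuous_map_preimage[OF cont[OF g(1)]] by blast
    then show ?thesis using AB y by (intro exI[of _ ?C]) (auto simp: disjnt_def)
  qed
  then obtain A where A: "\<And>g. \<lbrakk>g \<in> \<Gamma>; g y \<noteq> y\<rbrakk> \<Longrightarrow> openin S (A g) \<and> y \<in> A g \<and> (\<forall>w\<in>A g. g w \<notin> A g)"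
    by metis
  define W where "W = W0 \<inter> topspace S \<inter> \<Inter> (A ` {g \<in> \<Gamma>. g y \<noteq> y})"
  have W: "openin S W" "y \<in> W"
  proof -
    have "openin S (\<Inter> (insert W0 (A ` {g \<in> \<Gamma>. g y \<noteq> y})))"
      using A W0 fin by (intro openin_Inter) auto
    then have "openin S (topspace S \<inter> \<Inter> (insert W0 (A ` {g \<in> \<Gamma>. g y \<noteq> y})))" by blast
    then show "openin S W" by (simp add: W_def Int_ac)
    show "y \<in> W" using A W0 y by (auto simp: W_def)
  qed
  have WS: "W \<subseteq> topspace S" by (auto simp: W_def)
  have inj: "inj_on q W"
  proof (rule inj_onI)
    fix v w assume vw: "v \<in> W" "w \<in> W" "q v = q w"
    then obtain g where g: "g \<in> \<Gamma>" "w = g v" using orb WS by blast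
    have "g y = y"
    proof (rule ccontr)
      assume "g y \<noteq> y"
      then have "v \<in> A g" "w \<in> A g" "\<forall>w\<in>A g. g w \<notin> A g" using A g vw by (auto simp: W_def)
      then show False using g by blast
    qed
    then have "g = e" using free[OF g(1) e(1) y] e(2)[OF y] by simp
    then show "v = w" using g e(2) vw WS by auto
  qed
  have hom: "homeomorphic_map (subtopology S W) (subtopology N (q ` W)) q"
  proof (rule bijective_open_imp_homeomorphic_map)
    show "continuous_map (subtopology S W) (subtopology N (q ` W)) q"
      using quotient_imp_continuous_map[OF q] WS
      by (auto simp: continuous_map_in_subtopology continuous_map_from_subtopology)
    show "open_map (subtopology S W) (subtopology N (q ` W)) q"
      unfolding open_map_def
    proof (intro allI impI)
      fix U assume "openin (subtopology S W) U"
      then have "openin S U" "U \<subseteq> W" using W openin_open_subtopology by auto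
      then show "openin (subtopology N (q ` W)) (q ` U)"
        by (meson image_mono open_q openin_subset_topspace_eq openin_subtopology_Int2 openin_open_subtopology W(1))
    qed
    show "q ` topspace (subtopology S W) = topspace (subtopology N (q ` W))"
      using WS q quotient_imp_surjective_map[OF q] by auto
    show "inj_on q (topspace (subtopology S W))" using inj WS by (simp add: inf.absorb2)
  qed
  then obtain r where r: "homeomorphic_maps (subtopology S W) (subtopology N (q ` W)) q r"
    by (auto simp: homeomorphic_map_maps)
  show ?thesis
  proof
    show "openin N (q ` W)" using open_q W by blast
    show "q ` W \<noteq> {}" using W by blast
    show "continuous_map (subtopology N (q ` W)) (subtopology S W0) r"
      using r by (auto simp: homeomorphic_maps_def continuous_map_in_subtopology W_def)
    have "r (q w) = w" if "w \<in> W" for w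
      using r WS that by (auto simp: homeomorphic_maps_def)
    then show "inj_on r (q ` W)" by (auto intro!: inj_onI)
  qed
qed

text \<open>\<open>\<kappa>\<close> is the sine of the angle measured from y, and W is the open half
  circle on which the cosine is positive; there the sine determines the cosine and thus the
  point.\<close>

lemma Sph_1_local_coordinate:
  assumes "y \<in> Sph 1"
  obtains W \<kappa> where "openin (top_of_set (Sph 1)) W" "y \<in> W" "continuous_on W \<kappa>" "inj_on (\<kappa> :: _ \<Rightarrow> real) W"
proof
  let ?W = "{x \<in> Sph 1. 0 < x 0 * y 0 + x 1 * y 1}"
  let ?\<kappa> = "\<lambda>x :: nat \<Rightarrow> real. y 0 * x 1 - y 1 * x 0"
  have sph: "(x 0)\<^sup>2 + (x 1)\<^sup>2 = 1" "\<forall>i>1. x i = 0" if "x \<in> Sph 1" for x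
    using that by (auto simp: Sph_def)
  have "open {x :: nat \<Rightarrow> real. 0 < x 0 * y 0 + x 1 * y 1}"
    by (intro open_Collect_less continuous_intros continuous_on_product_coordinates)
  moreover have "?W = Sph 1 \<inter> {x. 0 < x 0 * y 0 + x 1 * y 1}" by blast
  ultimately show "openin (top_of_set (Sph 1)) ?W" by (simp add: openin_open_Int)
  show "y \<in> ?W" using assms sph[OF assms] by (simp add: power2_eq_square)
  show "continuous_on ?W ?\<kappa>"
    by (intro continuous_intros continuous_on_subset[OF continuous_on_product_coordinates]) auto
  show "inj_on ?\<kappa> ?W"
  proof (rule inj_onI)
    fix x x' assume x: "x \<in> ?W" and x': "x' \<in> ?W" and eq: "?\<kappa> x = ?\<kappa> x'"
    let ?c = "\<lambda>x :: nat \<Rightarrow> real. x 0 * y 0 + x 1 * y 1"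
    have c: "(?c x)\<^sup>2 = 1 - (?\<kappa> x)\<^sup>2" if "x \<in> Sph 1" for x
    proof -
      have "(?c x)\<^sup>2 + (?\<kappa> x)\<^sup>2 = ((x 0)\<^sup>2 + (x 1)\<^sup>2) * ((y 0)\<^sup>2 + (y 1)\<^sup>2)"
        by (simp add: power2_eq_square algebra_simps)
      then show ?thesis using sph[OF that] sph[OF assms] by simp
    qed
    have "(?c x)\<^sup>2 = (?c x')\<^sup>2" using c[of x] c[of x'] x x' eq by simp
    then have cc: "?c x = ?c x'" using x x' by (simp add: power2_eq_iff_nonneg)
    have rec: "x 0 = ?c x * y 0 - ?\<kappa> x * y 1" "x 1 = ?c x * y 1 + ?\<kappa> x * y 0" for x
    proof -
      have "?c x * y 0 - ?\<kappa> x * y 1 = x 0 * ((y 0)\<^sup>2 + (y 1)\<^sup>2)"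
        by (simp add: power2_eq_square algebra_simps)
      moreover have "?c x * y 1 + ?\<kappa> x * y 0 = x 1 * ((y 0)\<^sup>2 + (y 1)\<^sup>2)"
        by (simp add: power2_eq_square algebra_simps)
      ultimately show "x 0 = ?c x * y 0 - ?\<kappa> x * y 1" "x 1 = ?c x * y 1 + ?\<kappa> x * y 0"
        using sph[OF assms] by simp_all
    qed
    have "x 0 = x' 0" "x 1 = x' 1" using rec[of x] rec[of x'] cc eq by metis+
    then have "x i = x' i" for i
      using sph[of x] sph[of x'] x x' by (cases "i = 0"; cases "i = 1") auto
    then show "x = x'" by blast
  qed
qed

section \<open>Ends of the total space\<close>

text \<open>The orbit of b under rotation in one coordinate plane: a curve in the sphere starting at
  b.\<close>

definition rotate_coords :: "nat \<Rightarrow> nat \<Rightarrow> (nat \<Rightarrow> real) \<Rightarrow> real \<Rightarrow> nat \<Rightarrow> real" where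
  "rotate_coords i j b s = b(i := Re (cis s * Complex (b i) (b j)), j := Im (cis s * Complex (b i) (b j)))"

lemma rotate_coords_in_Sph:
  assumes b: "b \<in> Sph n" and ij: "i \<le> n" "j \<le> n" "i \<noteq> j"
  shows "rotate_coords i j b s \<in> Sph n"
proof -
  have split: "(\<Sum>l\<le>n. (f l)\<^sup>2) = (f i)\<^sup>2 + ((f j)\<^sup>2 + (\<Sum>l\<in>{..n} - {i} - {j}. (f l)\<^sup>2))" for f :: "nat \<Rightarrow> real"
    using ij by (simp add: sum.remove[of "{..n}" i] sum.remove[of "{..n} - {i}" j])
  have "(Re w)\<^sup>2 + (Im w)\<^sup>2 = (b i)\<^sup>2 + (b j)\<^sup>2" if "w = cis s * Complex (b i) (b j)" for w
  proof -
    have "(cmod w)\<^sup>2 = (cmod (Complex (b i) (b j)))\<^sup>2" by (simp add: that norm_mult)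
    then show ?thesis by (simp add: cmod_power2)
  qed
  then have "(\<Sum>l\<le>n. (rotate_coords i j b s l)\<^sup>2) = (\<Sum>l\<le>n. (b l)\<^sup>2)"
    unfolding split using ij by (simp add: rotate_coords_def)
  then show ?thesis using b ij by (auto simp: Sph_def rotate_coords_def)
qed

lemma rotate_coords_0: "rotate_coords i j b 0 = b"
  by (auto simp: rotate_coords_def)

lemma continuous_on_rotate_coords: "continuous_on UNIV (rotate_coords i j b)"
proof (rule continuous_on_coordinatewise_then_product)
  show "continuous_on UNIV (\<lambda>s. rotate_coords i j b s l)" for l
    by (cases "l = j"; cases "l = i") (auto simp: rotate_coords_def cis_conv_exp intro!: continuous_intros)
qed

text \<open>The bounds keep the two angles less than 2 pi apart, so equal values of
  \<open>cis\<close> force equal angles.\<close>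

lemma rotate_coords_inj:
  assumes "i \<noteq> j" "b i \<noteq> 0" "\<bar>s\<bar> < 1" "\<bar>t\<bar> < 1" "rotate_coords i j b s = rotate_coords i j b t"
  shows "s = t"
proof -
  let ?w = "Complex (b i) (b j)"
  have "rotate_coords i j b s i = rotate_coords i j b t i" "rotate_coords i j b s j = rotate_coords i j b t j" using assms by simp_all
  then have "cis s * ?w = cis t * ?w"
    using assms(1) unfolding rotate_coords_def by (intro complex_eqI) simp_all
  moreover have "?w \<noteq> 0" using assms(2) by (simp add: complex_eq_iff)
  ultimately have "exp (\<i> * of_real s) = exp (\<i> * of_real t)" by (simp add: cis_conv_exp)
  then have "\<i> * of_real s = \<i> * of_real t"
    by (rule exp_complex_eqI[rotated]) (use assms pi_gt3 in auto)
  then show ?thesis by simp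
qed

text \<open>Now only the homeomorphism type matters: (p, F) and \<Psi> identify E with the product
  of the sphere and the plane, and the linear structure is forgotten.\<close>

locale trivialized_plane_bundle =
  fixes E :: "'a topology" and n :: nat and p :: "'a \<Rightarrow> nat \<Rightarrow> real"
    and F :: "'a \<Rightarrow> complex" and \<Psi> :: "(nat \<Rightarrow> real) \<times> complex \<Rightarrow> 'a"
  assumes cont_p: "continuous_map E (top_of_set (Sph n)) p"
    and cont_F: "continuous_map E euclidean F"
    and cont_\<Psi>: "continuous_map (prod_topology (top_of_set (Sph n)) euclidean) E \<Psi>"
    and \<Psi>: "\<And>b z. b \<in> Sph n \<Longrightarrow> \<Psi> (b, z) \<in> topspace E \<and> p (\<Psi> (b, z)) = b \<and> F (\<Psi> (b, z)) = z"
    and \<Psi>_inv: "\<And>e. e \<in> topspace E \<Longrightarrow> \<Psi> (p e, F e) = e"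
begin

lemma p_in_Sph: "e \<in> topspace E \<Longrightarrow> p e \<in> Sph n"
  using cont_p by (auto simp: continuous_map_def)

lemma prod_top_eq: "prod_topology (top_of_set (Sph n)) euclidean = top_of_set (Sph n \<times> (UNIV :: complex set))"
  using prod_topology_subtopology_eu[of "Sph n" "UNIV :: complex set"] by simp

lemma Hausdorff_total: "Hausdorff_space E"
proof -
  have "continuous_map E (prod_topology (top_of_set (Sph n)) euclidean) (\<lambda>e. (p e, F e))"
    by (intro continuous_map_pairedI cont_p cont_F)
  then have "homeomorphic_maps E (prod_topology (top_of_set (Sph n)) euclidean) (\<lambda>e. (p e, F e)) \<Psi>"
    using cont_\<Psi> \<Psi> \<Psi>_inv unfolding homeomorphic_maps_def by (auto simp del: prod_topology_subtopology_eu)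
  then have "E homeomorphic_space prod_topology (top_of_set (Sph n)) (euclidean :: complex topology)"
    using homeomorphic_space_def by blast
  moreover have "Hausdorff_space (prod_topology (top_of_set (Sph n)) (euclidean :: complex topology))"
    unfolding prod_top_eq by (simp add: Hausdorff_space_subtopology)
  ultimately show ?thesis using homeomorphic_Hausdorff_space by blast
qed

lemma F_bounded_on_compact:
  assumes "compactin E K" obtains R where "0 < R" "\<And>e. e \<in> K \<Longrightarrow> cmod (F e) \<le> R"
proof -
  have "compact (F ` K)" using image_compactin[OF assms cont_F] by simp
  then obtain R where "0 < R" "\<forall>z\<in>F ` K. norm z \<le> R"
    using compact_imp_bounded bounded_pos by metis
  then show ?thesis using that by auto
qed

lemma compactin_sphere_bundle: "compactin E {e \<in> topspace E. cmod (F e) = R}"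
proof -
  have "compact (Sph n \<times> sphere (0::complex) R)" by (intro compact_Times compact_Sph compact_sphere)
  then have "compactin (top_of_set (Sph n \<times> (UNIV :: complex set))) (Sph n \<times> sphere 0 R)"
    by (auto simp: compactin_subtopology)
  then have "compactin E (\<Psi> ` (Sph n \<times> sphere 0 R))"
    using cont_\<Psi> unfolding prod_top_eq by (rule image_compactin)
  moreover have "\<Psi> ` (Sph n \<times> sphere 0 R) = {e \<in> topspace E. cmod (F e) = R}"
  proof (intro equalityI subsetI)
    fix e assume "e \<in> {e \<in> topspace E. cmod (F e) = R}"
    then have "e = \<Psi> (p e, F e)" "(p e, F e) \<in> Sph n \<times> sphere 0 R" using \<Psi>_inv p_in_Sph by auto
    then show "e \<in> \<Psi> ` (Sph n \<times> sphere 0 R)" by blast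
  qed (use \<Psi> in auto)
  ultimately show ?thesis by simp
qed

lemma cont_\<Psi>_fibre: "b \<in> Sph n \<Longrightarrow> continuous_on S f \<Longrightarrow> continuous_map (top_of_set S) E (\<lambda>z. \<Psi> (b, f z))"
  using continuous_map_compose[OF _ cont_\<Psi>, of "top_of_set S" "\<lambda>z. (b, f z)"]
  by (simp add: o_def continuous_map_pairedI del: prod_topology_subtopology_eu)

text \<open>As \<open>n\<close> is not a type, invariance of dimension is applied to the product of a single rotation
  direction in the base with the fibre.\<close>

lemma no_planar_open_set:
  assumes n: "1 \<le> n" and O: "openin E O'" "O' \<noteq> {}"
    and \<mu>: "continuous_map (subtopology E O') euclidean \<mu>" and inj: "inj_on (\<mu> :: 'a \<Rightarrow> real \<times> real) O'"
  shows False
proof -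
  obtain e where e: "e \<in> O'" using O by blast
  have OE: "O' \<subseteq> topspace E" using O openin_subset by blast
  define b where "b = p e"
  have b: "b \<in> Sph n" using e OE p_in_Sph by (auto simp: b_def)
  obtain i where i: "i \<le> n" "b i \<noteq> 0"
  proof (rule ccontr)
    assume "\<not> thesis"
    then have "\<forall>i\<le>n. b i = 0" using that by blast
    then show False using b by (simp add: Sph_def)
  qed
  obtain j where j: "j \<le> n" "i \<noteq> j" using n by (metis le0 zero_neq_one)
  let ?\<Phi> = "\<lambda>x :: real \<times> complex. \<Psi> (rotate_coords i j b (fst x), snd x)"
  have rot: "rotate_coords i j b s \<in> Sph n" for s using rotate_coords_in_Sph b i j by blast
  have "continuous_map euclidean (prod_topology (top_of_set (Sph n)) euclidean) (\<lambda>x :: real \<times> complex. (rotate_coords i j b (fst x), snd x))"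
  proof (rule continuous_map_pairedI)
    have "continuous_on UNIV (\<lambda>x :: real \<times> complex. rotate_coords i j b (fst x))"
      by (rule continuous_on_compose2[OF continuous_on_rotate_coords]) (auto intro!: continuous_intros)
    then show "continuous_map euclidean (top_of_set (Sph n)) (\<lambda>x :: real \<times> complex. rotate_coords i j b (fst x))"
      using rot by (auto simp: continuous_map_in_subtopology)
    show "continuous_map euclidean euclidean (snd :: real \<times> complex \<Rightarrow> complex)"
      by (simp add: continuous_on_snd)
  qed
  then have \<Phi>: "continuous_map euclidean E ?\<Phi>"
    using continuous_map_compose[OF _ cont_\<Psi>] by (fastforce simp: o_def)
  define D where "D = {x. ?\<Phi> x \<in> O'} \<inter> {x. \<bar>fst x\<bar> < 1}"
  have "open {x. ?\<Phi> x \<in> O'}"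
    using openin_continuous_map_preimage[OF \<Phi> O(1)] by simp
  moreover have "open {x :: real \<times> complex. \<bar>fst x\<bar> < 1}"
    by (intro open_Collect_less continuous_intros)
  ultimately have "open D" unfolding D_def by (rule open_Int)
  have "?\<Phi> (0, F e) = e" using \<Psi>_inv e OE by (auto simp: rotate_coords_0 b_def)
  then have "(0, F e) \<in> D" using e by (simp add: D_def)
  have "continuous_map (top_of_set D) (subtopology E O') ?\<Phi>"
    using continuous_map_from_subtopology[OF \<Phi>, of D] by (auto simp: continuous_map_in_subtopology D_def)
  then have "continuous_map (top_of_set D) euclidean (\<mu> \<circ> ?\<Phi>)" using \<mu> by (rule continuous_map_compose)
  then have "continuous_on D (\<mu> \<circ> ?\<Phi>)" by simp
  moreover have "inj_on (\<mu> \<circ> ?\<Phi>) D"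
  proof (rule comp_inj_on)
    show "inj_on ?\<Phi> D"
    proof (rule inj_onI)
      fix x y assume xy: "x \<in> D" "y \<in> D" "?\<Phi> x = ?\<Phi> y"
      have "rotate_coords i j b (fst x) = rotate_coords i j b (fst y)" "snd x = snd y"
        using xy(3) \<Psi>[OF rot] by metis+
      then show "x = y" using rotate_coords_inj[of i j b "fst x" "fst y"] xy i j by (auto simp: D_def prod_eq_iff)
    qed
    show "inj_on \<mu> (?\<Phi> ` D)" using inj by (rule inj_on_subset) (auto simp: D_def)
  qed
  \<comment> \<open>D is a nonempty open set in three dimensions, injected continuously into the
    plane.\<close>
  ultimately have "DIM(real \<times> complex) \<le> DIM(real \<times> real)"
    using invariance_of_dimension[OF _ \<open>open D\<close>, of "\<mu> \<circ> ?\<Phi>"] \<open>(0, F e) \<in> D\<close> by blast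
  then show False by simp
qed

text \<open>A finite free quotient of the circle has a local real coordinate. Together with the
  radial coordinate it embeds a nonempty open part of the end in the plane.\<close>

lemma no_circle_end:
  assumes n: "1 \<le> n" and U: "openin E U" "U \<noteq> {}"
    and hom: "(subtopology E U) homeomorphic_space (prod_topology (top_of_set {0::real<..}) N)"
    and act: "finite_free_group_action (nsphere 1) G" and N: "is_orbit_space (nsphere 1) G N"
  shows False
proof -
  let ?P = "prod_topology (top_of_set {0::real<..}) N"
  obtain \<theta> \<omega> where hm: "homeomorphic_maps (subtopology E U) ?P \<theta> \<omega>"
    using hom by (auto simp: homeomorphic_space_def)
  have UE: "U \<subseteq> topspace E" using U openin_subset by blast
  have \<theta>: "continuous_map (subtopology E U) ?P \<theta>" and \<omega>: "continuous_map ?P (subtopology E U) \<omega>"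
    and \<omega>\<theta>: "\<And>e. e \<in> U \<Longrightarrow> \<omega> (\<theta> e) = e" and \<theta>\<omega>: "\<And>s x. 0 < s \<Longrightarrow> x \<in> topspace N \<Longrightarrow> \<theta> (\<omega> (s, x)) = (s, x)"
    using hm UE by (auto simp: homeomorphic_maps_def)
  define y :: "nat \<Rightarrow> real" where "y = (\<lambda>i. if i = 0 then 1 else 0)"
  have y: "y \<in> Sph 1" unfolding y_def by (rule Sph_nonempty)
  obtain W \<kappa> where W: "openin (top_of_set (Sph 1)) W" "y \<in> W" and \<kappa>: "continuous_on W \<kappa>" "inj_on (\<kappa> :: _ \<Rightarrow> real) W"
    using Sph_1_local_coordinate[OF y] by blast
  have "Hausdorff_space (top_of_set (Sph 1))" by (simp add: Hausdorff_space_subtopology)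
  then obtain V r where V: "openin N V" "V \<noteq> {}" and r: "continuous_map (subtopology N V) (subtopology (top_of_set (Sph 1)) W) r" "inj_on r V"
    using orbit_space_local_section[of "top_of_set (Sph 1)" G N y W] act N y W
    unfolding nsphere_eq_top_of_set by auto
  have VN: "V \<subseteq> topspace N" using V openin_subset by blast
  have sub: "subtopology (top_of_set (Sph 1)) W = top_of_set W"
    using W openin_imp_subset by (metis subtopology_subtopology inf.absorb_iff2)
  define \<psi> where "\<psi> = \<kappa> \<circ> r"
  have \<psi>: "continuous_map (subtopology N V) euclideanreal \<psi>"
    unfolding \<psi>_def using r(1) \<kappa>(1) unfolding sub by (intro continuous_map_compose) auto
  have inj\<psi>: "inj_on \<psi> V"
    unfolding \<psi>_def
  proof (rule comp_inj_on[OF r(2)])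
    have "r ` V \<subseteq> W" using r(1) VN unfolding sub by (auto simp: continuous_map_def Pi_iff)
    then show "inj_on \<kappa> (r ` V)" using \<kappa>(2) inj_on_subset by blast
  qed
  let ?Q = "{0<..} \<times> V"
  define O' where "O' = {e \<in> U. \<theta> e \<in> ?Q}"
  have "openin ?P ?Q" using V by (auto simp: openin_prod_Times_iff)
  then have "openin (subtopology E U) {e \<in> topspace (subtopology E U). \<theta> e \<in> ?Q}"
    using openin_continuous_map_preimage[OF \<theta>] by blast
  moreover have "{e \<in> topspace (subtopology E U). \<theta> e \<in> ?Q} = O'" using UE by (auto simp: O'_def)
  ultimately have O': "openin E O'" using U(1) openin_trans_full by metis
  obtain x where x: "x \<in> V" using V by blast
  have "\<omega> (1, x) \<in> U" using \<omega> x VN by (auto simp: continuous_map_def Pi_iff)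
  moreover have "\<theta> (\<omega> (1, x)) \<in> ?Q" using \<theta>\<omega>[of 1 x] x VN by (simp add: subset_iff)
  ultimately have "\<omega> (1, x) \<in> O'" unfolding O'_def by (intro CollectI conjI)
  then have ne: "O' \<noteq> {}" by (metis empty_iff)
  define \<mu> where "\<mu> e = (fst (\<theta> e), \<psi> (snd (\<theta> e)))" for e
  have \<theta>': "continuous_map (subtopology E O') (prod_topology (top_of_set {0<..}) (subtopology N V)) \<theta>"
  proof -
    have "continuous_map (subtopology E O') ?P \<theta>"
      by (rule continuous_map_from_subtopology_mono[OF \<theta>]) (auto simp: O'_def)
    then have "continuous_map (subtopology E O') (subtopology ?P ?Q) \<theta>"
      by (auto simp: continuous_map_in_subtopology O'_def)
    moreover have "subtopology ?P ?Q = prod_topology (top_of_set {0<..}) (subtopology N V)"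
      using prod_topology_subtopology(2)[of "top_of_set {0<..}" N V] by (simp add: subtopology_subtopology Times_Int_Times prod_topology_subtopology)
    ultimately show ?thesis by simp
  qed
  have "continuous_map (subtopology E O') (prod_topology euclideanreal euclideanreal) \<mu>"
    unfolding \<mu>_def
  proof (rule continuous_map_pairedI)
    show "continuous_map (subtopology E O') euclideanreal (\<lambda>e. fst (\<theta> e))"
      using continuous_map_compose[OF \<theta>' continuous_map_fst] by (auto simp: o_def continuous_map_in_subtopology)
    show "continuous_map (subtopology E O') euclideanreal (\<lambda>e. \<psi> (snd (\<theta> e)))"
      using continuous_map_compose[OF continuous_map_compose[OF \<theta>' continuous_map_snd] \<psi>] by (simp add: o_def)
  qed
  then have "continuous_map (subtopology E O') euclidean \<mu>" by simp
  moreover have "inj_on \<mu> O'"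
  proof (rule inj_onI)
    fix d e assume de: "d \<in> O'" "e \<in> O'" "\<mu> d = \<mu> e"
    then have "snd (\<theta> d) = snd (\<theta> e)" using inj\<psi> by (auto simp: \<mu>_def O'_def inj_on_def mem_Times_iff)
    then have "\<theta> d = \<theta> e" using de by (simp add: \<mu>_def prod_eq_iff)
    then show "d = e" using \<omega>\<theta> de unfolding O'_def by (metis (no_types, lifting) mem_Collect_eq)
  qed
  ultimately show False using no_planar_open_set[OF n O' ne] by blast
qed

text \<open>The part of \<open>U\<close> where \<open>cmod (F e) = R\<close> lies over a compact interval \<open>[a,T]\<close>. Replacing \<open>F\<close> by 1 inside
  radius \<open>R\<close> is continuous over either component of its complement, and a large circle in the fibre over
  \<open>b\<close> can be moved within one component to a slice, where the power has a logarithm.\<close>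

lemma no_end_with_power_logs:
  assumes R: "0 < R" and U: "openin E U"
    and hom: "(subtopology E U) homeomorphic_space (prod_topology (top_of_set {0::real<..}) N)"
    and compN: "compact_space N" and k: "k \<noteq> 0"
    and logs: "\<And>f :: 'n \<Rightarrow> complex. \<lbrakk>continuous_map N euclidean f; \<And>x. x \<in> topspace N \<Longrightarrow> f x \<noteq> 0\<rbrakk> \<Longrightarrow>
       \<exists>g. continuous_map N euclidean g \<and> (\<forall>x\<in>topspace N. f x ^ k = exp (g x))"
    and b: "b \<in> Sph n" and fibre: "\<And>z. R < cmod z \<Longrightarrow> \<Psi> (b, z) \<in> U"
    and comp: "compactin E {e \<in> U. cmod (F e) = R}"
  shows False
proof -
  let ?I = "top_of_set {0::real<..}" and ?S = "sphere (0::complex) 1"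
  let ?P = "prod_topology ?I N"
  obtain \<theta> \<omega> where hm: "homeomorphic_maps (subtopology E U) ?P \<theta> \<omega>"
    using hom by (auto simp: homeomorphic_space_def)
  have UE: "U \<subseteq> topspace E" using U openin_subset by blast
  have \<theta>: "continuous_map (subtopology E U) ?P \<theta>" and \<omega>: "continuous_map ?P (subtopology E U) \<omega>"
    and \<omega>\<theta>: "\<And>e. e \<in> U \<Longrightarrow> \<omega> (\<theta> e) = e" and \<theta>\<omega>: "\<And>s x. 0 < s \<Longrightarrow> x \<in> topspace N \<Longrightarrow> \<theta> (\<omega> (s, x)) = (s, x)"
    using hm UE by (auto simp: homeomorphic_maps_def)
  have \<omega>U: "\<omega> (s, x) \<in> U" if "0 < s" "x \<in> topspace N" for s x
    using \<omega> that by (auto simp: continuous_map_def Pi_iff)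
  have \<theta>P: "fst (\<theta> e) > 0 \<and> snd (\<theta> e) \<in> topspace N" if "e \<in> U" for e
  proof -
    have "\<theta> e \<in> topspace ?P" using \<theta> that UE unfolding continuous_map_def Pi_iff by auto
    then show ?thesis by (auto simp: mem_Times_iff)
  qed
  obtain a T where aT: "0 < a" "a \<le> T" and aT_Z: "\<And>e. e \<in> U \<Longrightarrow> cmod (F e) = R \<Longrightarrow> fst (\<theta> e) \<in> {a..T}"
  proof -
    let ?Z = "{e \<in> U. cmod (F e) = R}"
    have "compactin (subtopology E U) ?Z" using comp by (auto simp: compactin_subtopology)
    then have "compactin ?I ((fst \<circ> \<theta>) ` ?Z)"
      using continuous_map_compose[OF \<theta> continuous_map_fst] by (rule image_compactin)
    then have I: "compact ((fst \<circ> \<theta>) ` ?Z)" "(fst \<circ> \<theta>) ` ?Z \<subseteq> {0<..}"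
      by (auto simp: compactin_subtopology)
    show ?thesis
    proof (cases "?Z = {}")
      case True
      \<comment> \<open>With no point of radius R in U, any interval will do.\<close>
      then show ?thesis using that[of 1 1] by auto
    next
      case False
      then have ne: "(fst \<circ> \<theta>) ` ?Z \<noteq> {}" by blast
      obtain a where a: "a \<in> (fst \<circ> \<theta>) ` ?Z" "\<forall>s\<in>(fst \<circ> \<theta>) ` ?Z. a \<le> s"
        using compact_attains_inf[OF I(1) ne] by blast
      obtain T where T: "T \<in> (fst \<circ> \<theta>) ` ?Z" "\<forall>s\<in>(fst \<circ> \<theta>) ` ?Z. s \<le> T"
        using compact_attains_sup[OF I(1) ne] by blast
      have "0 < a" using a I(2) by auto
      moreover have "a \<le> T" using a T by blast
      moreover have "fst (\<theta> e) \<in> {a..T}" if "e \<in> U" "cmod (F e) = R" for e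
      proof -
        have "fst (\<theta> e) \<in> (fst \<circ> \<theta>) ` ?Z" using that by auto
        from bspec[OF a(2) this] bspec[OF T(2) this] show ?thesis by simp
      qed
      ultimately show ?thesis by (rule that)
    qed
  qed
  have "compactin ?P ({a..T} \<times> topspace N)"
    using compN aT by (auto simp: compactin_Times compactin_subtopology compact_space_def)
  then have "compactin (subtopology E U) (\<omega> ` ({a..T} \<times> topspace N))"
    using \<omega> by (rule image_compactin)
  then have "compactin E (\<omega> ` ({a..T} \<times> topspace N))" by (simp add: compactin_subtopology)
  then obtain R0 where R0: "\<And>e. e \<in> \<omega> ` ({a..T} \<times> topspace N) \<Longrightarrow> cmod (F e) \<le> R0"
    using F_bounded_on_compact by metis
  \<comment> \<open>Beyond R the fibre circle lies in U and \<open>\<kappa>\<close> leaves it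
    unchanged; beyond R0 it misses the compact part of the end over [a, T].\<close>
  define R2 where "R2 = max R R0 + 1"
  have R2: "R < R2" "R0 < R2" by (auto simp: R2_def)
  define c where "c z = \<theta> (\<Psi> (b, of_real R2 * z))" for z
  have circ: "\<Psi> (b, of_real R2 * z) \<in> U" if "z \<in> ?S" for z
    by (rule fibre) (use that R R2 in \<open>simp add: norm_mult\<close>)
  have "continuous_map (top_of_set ?S) (subtopology E U) (\<lambda>z. \<Psi> (b, of_real R2 * z))"
    using cont_\<Psi>_fibre[OF b, of ?S "\<lambda>z. of_real R2 * z"] circ
    by (auto simp: continuous_map_in_subtopology intro!: continuous_intros)
  from continuous_map_compose[OF this \<theta>] have c: "continuous_map (top_of_set ?S) ?P c"
    by (simp add: o_def c_def[abs_def])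
  have c_fst: "continuous_on ?S (\<lambda>z. fst (c z))" and c_snd: "continuous_map (top_of_set ?S) N (\<lambda>z. snd (c z))"
    using continuous_map_compose[OF c continuous_map_fst] continuous_map_compose[OF c continuous_map_snd]
    by (simp_all add: o_def continuous_map_in_subtopology)
  have cN: "fst (c z) > 0" "snd (c z) \<in> topspace N" if "z \<in> ?S" for z
    using \<theta>P[OF circ[OF that]] by (simp_all add: c_def)
  have F_c: "F (\<omega> (c z)) = of_real R2 * z" if "z \<in> ?S" for z
    using \<omega>\<theta>[OF circ[OF that]] \<Psi>[OF b] by (simp add: c_def)
  have c_out: "fst (c z) \<notin> {a..T}" if z: "z \<in> ?S" for z
  proof
    assume "fst (c z) \<in> {a..T}"
    then have "\<omega> (c z) \<in> \<omega> ` ({a..T} \<times> topspace N)" using cN(2)[OF z] by (simp add: mem_Times_iff)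
    then have "cmod (F (\<omega> (c z))) \<le> R0" by (rule R0)
    then show False using F_c[OF z] z R R2 by (simp add: norm_mult)
  qed
  have conn: "connected ?S" by (rule connected_sphere) simp
  \<comment> \<open>The circle is connected and its radial coordinate avoids [a, T], so it stays on
    one side of the midpoint, and thereby below a or above T.\<close>
  have "(\<forall>z\<in>?S. 0 < fst (c z) - (a + T) / 2) \<or> (\<forall>z\<in>?S. fst (c z) - (a + T) / 2 < 0)"
  proof (rule connected_nonzero_sign[OF conn])
    show "continuous_on ?S (\<lambda>z. fst (c z) - (a + T) / 2)" by (intro continuous_intros c_fst)
    show "fst (c z) - (a + T) / 2 \<noteq> 0" if "z \<in> ?S" for z using c_out[OF that] aT by auto
  qed
  then obtain J t where J: "convex J" "J \<subseteq> {0<..}" "J \<inter> {a..T} = {}" "t \<in> J" "\<And>z. z \<in> ?S \<Longrightarrow> fst (c z) \<in> J"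
  proof
    assume "\<forall>z\<in>?S. 0 < fst (c z) - (a + T) / 2"
    then have "fst (c z) \<in> {T<..}" if "z \<in> ?S" for z using c_out[OF that] that aT by force
    moreover have "{T<..} \<inter> {a..T} = {}" by auto
    ultimately show ?thesis using that[of "{T<..}" "T + 1"] aT by auto
  next
    assume "\<forall>z\<in>?S. fst (c z) - (a + T) / 2 < 0"
    then have "fst (c z) \<in> {0<..<a}" if "z \<in> ?S" for z using c_out[OF that] cN(1)[OF that] that aT by force
    moreover have "{0<..<a} \<inter> {a..T} = {}" "{0<..<a} \<subseteq> {0<..}" by auto
    ultimately show ?thesis using that[of "{0<..<a}" "a / 2"] aT by auto
  qed
  \<comment> \<open>F itself may vanish inside U, so it need not have a logarithm of a power on a
    slice. The jump of \<open>\<kappa>\<close> at radius R does no harm, as points with radial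
    coordinate in J never have that radius.\<close>
  define \<kappa> where "\<kappa> w = (if R < cmod w then w else 1)" for w
  have "{w. cmod w \<noteq> R} = {w. R < cmod w} \<union> {w. cmod w < R}" by auto
  moreover have "open {w :: complex. R < cmod w}" "open {w :: complex. cmod w < R}"
    by (intro open_Collect_less continuous_intros)+
  moreover have "continuous_on {w. R < cmod w} \<kappa>" "continuous_on {w. cmod w < R} \<kappa>"
    by (auto simp: \<kappa>_def cong: continuous_on_cong_simp intro: continuous_on_eq[of _ "\<lambda>w. w"] continuous_on_eq[of _ "\<lambda>w. 1"])
  ultimately have \<kappa>: "continuous_on {w. cmod w \<noteq> R} \<kappa>" by (simp add: continuous_on_open_Un)
  have \<kappa>_nz: "\<kappa> w \<noteq> 0" for w using R by (auto simp: \<kappa>_def)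
  define f where "f x = \<kappa> (F (\<omega> x))" for x
  have "continuous_map (prod_topology (top_of_set J) N) ?P (\<lambda>x. (fst x, snd x))"
    using J(2) by (intro continuous_map_pairedI)
      (auto simp: continuous_map_in_subtopology continuous_map_from_subtopology intro: continuous_map_fst continuous_map_snd
        continuous_map_into_fulltopology[OF continuous_map_fst])
  then have "continuous_map (prod_topology (top_of_set J) N) (subtopology E U) \<omega>"
    using continuous_map_compose[OF _ \<omega>] by (fastforce simp: o_def)
  then have "continuous_map (prod_topology (top_of_set J) N) euclidean (F \<circ> \<omega>)"
    using cont_F continuous_map_compose continuous_map_in_subtopology by blast
  moreover have "cmod (F (\<omega> (s, x))) \<noteq> R" if "s \<in> J" "x \<in> topspace N" for s x
    using aT_Z[of "\<omega> (s, x)"] \<omega>U[of s x] \<theta>\<omega>[of s x] that J(2,3) by force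
  ultimately have "continuous_map (prod_topology (top_of_set J) N) (top_of_set {w. cmod w \<noteq> R}) (F \<circ> \<omega>)"
    by (simp add: continuous_map_in_subtopology Pi_iff image_subset_iff)
  then have f: "continuous_map (prod_topology (top_of_set J) N) euclidean f"
    using continuous_map_compose[of _ "top_of_set {w. cmod w \<noteq> R}" "F \<circ> \<omega>" euclidean \<kappa>] \<kappa>
    by (simp add: o_def f_def[abs_def])
  have "continuous_map N (prod_topology (top_of_set J) N) (\<lambda>x. (t, x))"
    using J(4) by (intro continuous_map_pairedI) auto
  from continuous_map_compose[OF this f] have "continuous_map N euclidean (\<lambda>x. f (t, x))" by (simp add: o_def)
  then obtain g where g: "continuous_map N euclidean g" "\<And>x. x \<in> topspace N \<Longrightarrow> f (t, x) ^ k = exp (g x)"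
    using logs[of "\<lambda>x. f (t, x)"] \<kappa>_nz by (auto simp: f_def)
  \<comment> \<open>Slides the radial coordinate of the circle linearly to t, inside the convex set
    J, and keeps its component in N.\<close>
  define h where "h x = ((1 - fst x) * fst (c (snd x)) + fst x * t, snd (c (snd x)))" for x :: "real \<times> complex"
  have h: "continuous_map (top_of_set ({0..1} \<times> ?S)) (prod_topology (top_of_set J) N) h"
    unfolding h_def
  proof (rule continuous_map_pairedI)
    have "continuous_on ({0..1} \<times> ?S) (\<lambda>x. (1 - fst x) * fst (c (snd x)) + fst x * t)"
      by (intro continuous_intros continuous_on_compose2[OF c_fst]) auto
    moreover have "(1 - u) * fst (c z) + u * t \<in> J" if "u \<in> {0..1}" "z \<in> ?S" for u z
      using convexD[OF J(1) J(5)[OF that(2)] J(4), of "1 - u" u] that by simp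
    ultimately show "continuous_map (top_of_set ({0..1} \<times> ?S)) (top_of_set J) (\<lambda>x. (1 - fst x) * fst (c (snd x)) + fst x * t)"
      by auto
    have "continuous_map (top_of_set ({0..1::real} \<times> ?S)) (top_of_set ?S) snd" by (auto intro: continuous_intros)
    from continuous_map_compose[OF this c_snd]
    show "continuous_map (top_of_set ({0..1::real} \<times> ?S)) N (\<lambda>x. snd (c (snd x)))" by (simp add: o_def)
  qed
  have "continuous_map (top_of_set ({0..1} \<times> ?S)) euclidean (f \<circ> h)" using h f by (rule continuous_map_compose)
  then have "continuous_on ({0..1} \<times> ?S) (\<lambda>x. f (h x) ^ k)" by (intro continuous_intros) (simp add: o_def)
  then have "homotopic_with_canon (\<lambda>_. True) ?S (- {0}) (\<lambda>z. f (h (0, z)) ^ k) (\<lambda>z. f (h (1, z)) ^ k)"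
    using \<kappa>_nz by (intro homotopic_with[THEN iffD2]) (auto simp: f_def intro!: exI[of _ "\<lambda>x. f (h x) ^ k"])
  \<comment> \<open>At the end of the homotopy the map factors through the slice at t, where g is a
    logarithm. Null-homotopy then passes back to the original circle.\<close>
  moreover have "\<exists>w. homotopic_with_canon (\<lambda>_. True) ?S (- {0}) (\<lambda>z. f (h (1, z)) ^ k) (\<lambda>z. w)"
    unfolding inessential_eq_continuous_logarithm
  proof (intro exI conjI)
    show "continuous_on ?S (\<lambda>z. g (snd (c z)))"
      using continuous_map_compose[OF c_snd g(1)] by (simp add: o_def)
    show "\<forall>z\<in>?S. f (h (1, z)) ^ k = exp (g (snd (c z)))" using g(2) cN(2) by (simp add: h_def)
  qed
  ultimately have "\<exists>w. homotopic_with_canon (\<lambda>_. True) ?S (- {0}) (\<lambda>z. f (h (0, z)) ^ k) (\<lambda>z. w)"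
    using homotopic_with_trans by blast
  then obtain l where l: "continuous_on ?S l" "\<forall>z\<in>?S. f (h (0, z)) ^ k = exp (l z)"
    unfolding inessential_eq_continuous_logarithm by blast
  have "f (h (0, z)) = of_real R2 * z" if "z \<in> ?S" for z
    using F_c[OF that] that R R2 by (simp add: f_def h_def \<kappa>_def norm_mult)
  then show False
    using no_log_power_circle[OF k _ l(1), of "of_real R2"] l(2) R R2 by auto
qed

text \<open>The part of one fibre beyond radius R is connected and avoids K, so a single end U
  contains all of it; the argument concerns this end.\<close>

lemma not_top_ALE:
  assumes n: "1 \<le> n" shows "\<not> top_ALE E"
proof
  assume "top_ALE E"
  then obtain K \<E> where K: "compactin E K" and disj: "pairwise disjnt \<E>" and Un: "\<Union>\<E> = topspace E - K"
    and ends: "\<forall>U \<in> \<E>. openin (subtopology E (topspace E - K)) U \<and>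
           (\<exists>N :: (nat \<Rightarrow> real) set topology. spherical_space_form N \<and>
              (subtopology E U) homeomorphic_space (prod_topology (subtopology euclideanreal {0<..}) N))"
    unfolding top_ALE_def by (elim exE conjE) (rule that, assumption+)
  have "openin E (topspace E - K)"
    using compactin_imp_closedin[OF Hausdorff_total K] by blast
  then have openE: "openin E U" if "U \<in> \<E>" for U
    using bspec[OF ends that] openin_trans_full by blast
  obtain R0 where R0: "0 < R0" "\<And>e. e \<in> K \<Longrightarrow> cmod (F e) \<le> R0"
    using F_bounded_on_compact[OF K] by blast
  \<comment> \<open>Strictly larger than every radius in K, so that the sphere bundle of radius R is
    disjoint from K.\<close>
  define R where "R = R0 + 1"
  have R: "0 < R" "\<And>e. e \<in> K \<Longrightarrow> cmod (F e) < R" using R0(1) R0(2) by (auto simp: R_def) (smt (verit))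
  define b :: "nat \<Rightarrow> real" where "b = (\<lambda>i. if i = 0 then 1 else 0)"
  have b: "b \<in> Sph n" unfolding b_def by (rule Sph_nonempty)
  let ?S = "{z. R < cmod z}"
  let ?L = "(\<lambda>z. \<Psi> (b, z)) ` ?S"
  have "connected (- cball (0::complex) R)"
    by (rule connected_complement_bounded_convex) auto
  moreover have "- cball (0::complex) R = ?S" by auto
  ultimately have "connectedin (top_of_set ?S) ?S" by (simp add: connectedin_subtopology)
  then have conL: "connectedin E ?L"
    using connectedin_continuous_map_image[OF cont_\<Psi>_fibre[OF b continuous_on_id, of ?S]] by simp
  have LU: "\<Psi> (b, z) \<in> \<Union>\<E>" if "z \<in> ?S" for z
    using \<Psi>[OF b, of z] R(2)[of "\<Psi> (b, z)"] that unfolding Un by auto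
  define z0 :: complex where "z0 = of_real (R + 1)"
  have z0: "z0 \<in> ?S" using R(1) unfolding z0_def by (simp del: of_real_add)
  then obtain U where U: "U \<in> \<E>" "\<Psi> (b, z0) \<in> U" using LU by blast
  let ?V = "\<Union>(\<E> - {U})"
  have V: "openin E ?V" using openE by blast
  have UV: "U \<inter> ?V = {}"
    using disj U(1) unfolding pairwise_def disjnt_def by blast
  have "?L \<inter> ?V = {}"
  proof (rule ccontr)
    assume ne: "?L \<inter> ?V \<noteq> {}"
    have "?L \<subseteq> U \<union> ?V" using LU by blast
    moreover have "U \<inter> ?V \<inter> ?L = {}" "U \<inter> ?L \<noteq> {}" "?V \<inter> ?L \<noteq> {}"
      using UV U(2) z0 ne by blast+
    ultimately show False using conL openE[OF U(1)] V unfolding connectedin by blast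
  qed
  then have fibre: "\<Psi> (b, z) \<in> U" if "R < cmod z" for z using LU[of z] that by blast
  \<comment> \<open>At radius R, lying in U means avoiding the union of the other ends. This is a
    closed condition, so U cuts a compact piece out of the sphere bundle.\<close>
  have eq: "{e \<in> U. cmod (F e) = R} = (topspace E - ?V) \<inter> {e \<in> topspace E. cmod (F e) = R}"
  proof -
    have "e \<in> U" if "e \<in> topspace E" "e \<notin> ?V" "cmod (F e) = R" for e
      using that Un R(2)[of e] by blast
    moreover have "U \<subseteq> topspace E" using openE[OF U(1)] openin_subset by blast
    ultimately show ?thesis using UV by blast
  qed
  have "closedin E (topspace E - ?V)" using V by blast
  then have comp: "compactin E {e \<in> U. cmod (F e) = R}"
    unfolding eq by (rule closed_Int_compactin[OF _ compactin_sphere_bundle])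
  obtain N :: "(nat \<Rightarrow> real) set topology" where N: "spherical_space_form N"
      "(subtopology E U) homeomorphic_space (prod_topology (top_of_set {0::real<..}) N)"
    using bspec[OF ends U(1)] by (elim conjE exE) (rule that)
  obtain m G where act: "finite_free_group_action (nsphere m) G" and orb: "is_orbit_space (nsphere m) G N"
    using N(1) unfolding spherical_space_form_def by (elim exE conjE) (rule that)
  show False
  proof (cases "m = 1")
    case True
    have "U \<noteq> {}" using U(2) by blast
    with True show False using no_circle_end[OF n openE[OF U(1)] _ N(2)] act orb by simp
  next
    case False
    obtain k :: nat where k: "k \<noteq> 0"
      "\<And>f :: (nat \<Rightarrow> real) set \<Rightarrow> complex. \<lbrakk>continuous_map N euclidean f; \<And>x. x \<in> topspace N \<Longrightarrow> f x \<noteq> 0\<rbrakk> \<Longrightarrow>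
         \<exists>g. continuous_map N euclidean g \<and> (\<forall>x\<in>topspace N. f x ^ k = exp (g x))"
      using orbit_space_power_log[OF act[unfolded nsphere_eq_top_of_set] orb[unfolded nsphere_eq_top_of_set] has_logs_Sph[OF False]]
        Sph_nonempty[of m] by (metis empty_iff)
    obtain q where q: "quotient_map (top_of_set (Sph m)) N q"
      using orb unfolding is_orbit_space_def nsphere_eq_top_of_set by blast
    have "compactin (top_of_set (Sph m)) (Sph m)" using compact_Sph by (simp add: compactin_subtopology)
    then have "compactin N (q ` Sph m)" using quotient_imp_continuous_map[OF q] by (rule image_compactin)
    then have "compact_space N" using quotient_imp_surjective_map[OF q] by (simp add: compact_space_def)
    then show False
      by (rule no_end_with_power_logs[OF R(1) openE[OF U(1)] N(2) _ k(1) k(2) b fibre comp])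
  qed
qed

end

theorem theorem2p8:
  fixes n :: nat and E :: "'a topology" and p :: "'a \<Rightarrow> (nat \<Rightarrow> real)"
  assumes "n > 2"
    and "real_vector_bundle E (nsphere n) p TYPE(real^2)"
  shows "\<not> top_ALE E"
proof -
  obtain add scale where "sphere_plane_bundle E n p add scale"
    using real_vector_bundle_imp_sphere_plane_bundle[OF assms(2)] by blast
  then interpret sphere_plane_bundle E n p add scale .
  obtain F where F: "trivialization (Sph n) F" using trivialization_sphere[OF assms(1)] by blast
  obtain \<Psi> where \<Psi>: "continuous_map (prod_topology (top_of_set (Sph n)) euclidean) E \<Psi>"
    "\<And>b z. b \<in> Sph n \<Longrightarrow> \<Psi> (b, z) \<in> topspace E \<and> p (\<Psi> (b, z)) = b \<and> F (\<Psi> (b, z)) = z"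
    "\<And>e. e \<in> topspace E \<Longrightarrow> \<Psi> (p e, F e) = e"
    using trivialization_inverse[OF F] by blast
  have "subtopology E {e \<in> topspace E. p e \<in> Sph n} = E"
    using cont_p by (intro subtopology_superset) (auto simp: continuous_map_def Pi_iff)
  then have "continuous_map E euclidean F" using F by (simp add: trivialization_def)
  then interpret trivialized_plane_bundle E n p F \<Psi>
    using cont_p \<Psi> by unfold_locales
  show ?thesis using not_top_ALE assms(1) by simp
qed

end
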